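(* Let $f=\{f_w\}_w$ be a continuous bundle random dynamical system (RDS) over $(\Omega,\mathcal{F},\mathbb{P},\theta)$ with associated skew product $F:\mathcal{E}\to\mathcal{E}$, and let $\mu\in\mathcal{M}(\mathcal{E},f)$ be an ergodic measure with disintegration $(\mu_w)_{w\in\Omega}$. If the relative entropy satisfies $h_\mu(f)>0$, then: (1) the measure $\mu$ is positively random expansive, i.e. there exists a random variable $\delta:\Omega\to(0,+\infty)$ such that for $\mathbb{P}$-a.e. $w$ one has $\mu_w(\Gamma^+_\delta(x,w))=0$ for all $x\in\mathcal{E}_w$; (2) for $\mathbb{P}$-a.e. $w$, every $w$-stable class has measure zero with respect to the conditional measure $\mu_w$ of $\mu$, i.e. $\mu_w(W^s_w(p))=0$ for all $p\in\mathcal{E}_w$.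
   Context: Setting. $(\Omega,\mathcal{F},\mathbb{P})$ is a Polish space with a probability measure, $\theta:\Omega\to\Omega$ is an invertible $\mathbb{P}$-preserving map, $X$ is a compact metric space with distance $d$ and Borel $\sigma$-algebra $\mathcal{B}$. $\mathcal{E}\subset\Omega\times X$ is measurable for $\mathcal{F}\times\mathcal{B}$ and the fibers $\mathcal{E}_w=\{x\in X:(w,x)\in\mathcal{E}\}$ are compact. A continuous bundle RDS $f=\{f_w\}_w$ is given by maps $f_w:\mathcal{E}_w\to\mathcal{E}_{\theta(w)}$ such that $(w,x)\mapsto f_w(x)$ is measurable and $x\mapsto f_w(x)$ is continuous for $\mathbb{P}$-a.e. $w$. The skew product is $F(w,x)=(\theta(w),f_w(x))$. For $n\ge1$, $f_w^n=f_{\theta^{n-1}(w)}\circ\cdots\circ f_w$, and $f_w^0=\mathrm{Id}$. Measures. $\mathcal{P}_{\mathbb{P}}(\mathcal{E})$ is the set of probability measures $\mu$ on $\Omega\times X$ with marginal $\mathbb{P}$ on $\Omega$ and $\mu(\mathcal{E})=1$. Each such $\mu$ disintegrates as $d\mu(w,x)=d\mu_w(x)\,d\mathbb{P}(w)$ with $\mu_w$ a probability measure on $\mathcal{E}_w$ for $\mathbb{P}$-a.e. $w$. $\mathcal{M}(\mathcal{E},f)$ is the set of $F$-invariant elements of $\mathcal{P}_{\mathbb{P}}(\mathcal{E})$ (equivalently $\mu_w\circ f_w^{-1}=\mu_{\theta(w)}$ for $\mathbb{P}$-a.e. $w$); $\mu$ is ergodic if $F$ is ergodic with respect to $\mu$.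 Entropy. Let $\mathcal{F}_{\mathcal{E}}$ be the $\sigma$-algebra of sets $(A\times X)\cap\mathcal{E}$, $A\in\mathcal{F}$. For a finite or countable measurable partition $\mathcal{R}=\{R_i\}$ of $\mathcal{E}$, put $R_i(w)=\{x\in\mathcal{E}_w:(w,x)\in R_i\}$, $\mathcal{R}(w)=\{R_i(w)\}$, and $H_\mu(\mathcal{R}|\mathcal{F}_{\mathcal{E}})=\int H_{\mu_w}(\mathcal{R}(w))\,d\mathbb{P}(w)$, where $H_{\mu_w}$ is the usual entropy of a partition. Then $h_\mu(f,\mathcal{R})=\lim_{n\to\infty}\frac1n H_\mu\big(\bigvee_{i=0}^{n-1}(F^i)^{-1}\mathcal{R}\,\big|\,\mathcal{F}_{\mathcal{E}}\big)$, and the relative entropy is $h_\mu(f)=h_\mu(F|\theta)=\sup_{\mathcal{R}}h_\mu(f,\mathcal{R})$, the supremum over finite measurable partitions $\mathcal{R}$ of $\mathcal{E}$. Expansivity. A random variable is a measurable function $\delta:\Omega\to(0,+\infty)$. $\Gamma^+_\delta(x,w)=\{y\in\mathcal{E}_w: d(f_w^k(x),f_w^k(y))\le\delta(\theta^k(w))\text{ for all }k\ge0\}$. Stable classes. For $p\in\mathcal{E}_w$, $W^s_w(p)=\{x\in\mathcal{E}_w:\lim_{n\to+\infty}d(f_w^n(x),f_w^n(p))=0\}$; a $w$-stable class is a set of the form $W^s_w(p)$ with $p\in\mathcal{E}_w$. *)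

theory Defs
  imports "HOL-Probability.Probability"
begin

definition fiber :: "('w \<times> 'x) set \<Rightarrow> 'w \<Rightarrow> 'x set" where
  "fiber E w = {x. (w, x) \<in> E}"

text \<open>
  The compact metric space is a type of class \<^class>\<open>polish_space\<close> whose universe is compact; this
  is no restriction, as compact metric spaces are complete and separable. The maps \<open>f w\<close> are total
  functions, but only their values on \<open>fiber E w\<close> are constrained.
\<close>

locale bundle_rds = prob_space P
  for P :: "'w :: polish_space measure"
    and \<theta> :: "'w \<Rightarrow> 'w"
    and E :: "('w \<times> 'x :: polish_space) set"
    and f :: "'w \<Rightarrow> 'x \<Rightarrow> 'x" +
  assumes sets_base: "sets P = sets borel"
    and base_bij: "bij \<theta>"
    and base_measurable: "\<theta> \<in> P \<rightarrow>\<^sub>M P"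
    and base_inv_measurable: "inv \<theta> \<in> P \<rightarrow>\<^sub>M P"
    and base_preserving: "distr P P \<theta> = P"
    and compact_space: "compact (UNIV :: 'x set)"
    and bundle_sets: "E \<in> sets (P \<Otimes>\<^sub>M borel)"
    and fiber_compact: "\<And>w. compact (fiber E w)"
    and fiber_map: "\<And>w x. x \<in> fiber E w \<Longrightarrow> f w x \<in> fiber E (\<theta> w)"
    and map_measurable: "(\<lambda>(w, x). f w x) \<in> restrict_space (P \<Otimes>\<^sub>M borel) E \<rightarrow>\<^sub>M borel"
    and map_continuous: "AE w in P. continuous_on (fiber E w) (f w)"

definition skew_product :: "('w \<Rightarrow> 'w) \<Rightarrow> ('w \<Rightarrow> 'x \<Rightarrow> 'x) \<Rightarrow> 'w \<times> 'x \<Rightarrow> 'w \<times> 'x" where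
  "skew_product \<theta> f = (\<lambda>(w, x). (\<theta> w, f w x))"

fun cocycle :: "('w \<Rightarrow> 'w) \<Rightarrow> ('w \<Rightarrow> 'x \<Rightarrow> 'x) \<Rightarrow> nat \<Rightarrow> 'w \<Rightarrow> 'x \<Rightarrow> 'x" where
  "cocycle \<theta> f 0 w x = x"
| "cocycle \<theta> f (Suc n) w x = f ((\<theta> ^^ n) w) (cocycle \<theta> f n w x)"

definition bundle_measures ::
    "'w measure \<Rightarrow> ('w \<times> 'x :: topological_space) set \<Rightarrow> ('w \<times> 'x) measure set" where
  "bundle_measures P E =
    {\<mu>. sets \<mu> = sets (P \<Otimes>\<^sub>M borel) \<and> prob_space \<mu> \<and> distr \<mu> P fst = P \<and> emeasure \<mu> E = 1}"

text \<open>
  The skew product is a self-map of \<open>E\<close> and is measurable only there, so invariance and ergodicity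
  are expressed with preimages inside \<open>E\<close> rather than with \<^const>\<open>distr\<close> on the whole product.
\<close>

definition invariant_measures ::
    "'w measure \<Rightarrow> ('w \<Rightarrow> 'w) \<Rightarrow> ('w \<times> 'x :: topological_space) set \<Rightarrow> ('w \<Rightarrow> 'x \<Rightarrow> 'x)
      \<Rightarrow> ('w \<times> 'x) measure set" where
  "invariant_measures P \<theta> E f =
    {\<mu> \<in> bundle_measures P E.
      \<forall>A \<in> sets \<mu>. A \<subseteq> E \<longrightarrow> emeasure \<mu> (E \<inter> skew_product \<theta> f -` A) = emeasure \<mu> A}"

definition ergodic_measure ::
    "('w \<Rightarrow> 'w) \<Rightarrow> ('w \<times> 'x) set \<Rightarrow> ('w \<Rightarrow> 'x \<Rightarrow> 'x) \<Rightarrow> ('w \<times> 'x) measure \<Rightarrow> bool" where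
  "ergodic_measure \<theta> E f \<mu> \<longleftrightarrow>
    (\<forall>A \<in> sets \<mu>. A \<subseteq> E \<longrightarrow> E \<inter> skew_product \<theta> f -` A = A \<longrightarrow>
      emeasure \<mu> A = 0 \<or> emeasure \<mu> A = 1)"

definition disintegration ::
    "'w measure \<Rightarrow> ('w \<times> 'x :: topological_space) set \<Rightarrow> ('w \<times> 'x) measure
      \<Rightarrow> ('w \<Rightarrow> 'x measure) \<Rightarrow> bool" where
  "disintegration P E \<mu> \<kappa> \<longleftrightarrow>
    \<kappa> \<in> P \<rightarrow>\<^sub>M prob_algebra borel \<and>
    (AE w in P. emeasure (\<kappa> w) (fiber E w) = 1) \<and>
    (\<forall>A \<in> sets \<mu>. emeasure \<mu> A = (\<integral>\<^sup>+ w. emeasure (\<kappa> w) (fiber A w) \<partial>P))"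

definition partition_entropy :: "'x measure \<Rightarrow> 'x set set \<Rightarrow> ennreal" where
  "partition_entropy m R =
    (\<integral>\<^sup>+ A. ennreal (- (measure m A * ln (measure m A))) \<partial>count_space R)"

definition fiber_partition :: "('w \<times> 'x) set set \<Rightarrow> 'w \<Rightarrow> 'x set set" where
  "fiber_partition R w = (\<lambda>A. fiber A w) ` R"

definition cond_entropy ::
    "'w measure \<Rightarrow> ('w \<Rightarrow> 'x measure) \<Rightarrow> ('w \<times> 'x) set set \<Rightarrow> ennreal" where
  "cond_entropy P \<kappa> R = (\<integral>\<^sup>+ w. partition_entropy (\<kappa> w) (fiber_partition R w) \<partial>P)"

text \<open>
  The nonempty atoms of the join of the preimages of \<open>R\<close> under the first \<open>n\<close> iterates; the
  function \<open>c\<close> is an itinerary.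
\<close>

definition iterated_join ::
    "('w \<Rightarrow> 'w) \<Rightarrow> ('w \<times> 'x) set \<Rightarrow> ('w \<Rightarrow> 'x \<Rightarrow> 'x) \<Rightarrow> ('w \<times> 'x) set set \<Rightarrow> nat
      \<Rightarrow> ('w \<times> 'x) set set" where
  "iterated_join \<theta> E f R n =
    {E \<inter> (\<Inter>i<n. (skew_product \<theta> f ^^ i) -` c i) | c. \<forall>i<n. c i \<in> R} - {{}}"

definition partition_relative_entropy ::
    "'w measure \<Rightarrow> ('w \<Rightarrow> 'w) \<Rightarrow> ('w \<times> 'x) set \<Rightarrow> ('w \<Rightarrow> 'x \<Rightarrow> 'x) \<Rightarrow> ('w \<Rightarrow> 'x measure)
      \<Rightarrow> ('w \<times> 'x) set set \<Rightarrow> ennreal" where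
  "partition_relative_entropy P \<theta> E f \<kappa> R =
    lim (\<lambda>n. cond_entropy P \<kappa> (iterated_join \<theta> E f R n) / of_nat n)"

definition finite_measurable_partition ::
    "'w measure \<Rightarrow> ('w \<times> 'x :: topological_space) set \<Rightarrow> ('w \<times> 'x) set set \<Rightarrow> bool" where
  "finite_measurable_partition P E R \<longleftrightarrow>
    finite R \<and> R \<subseteq> sets (P \<Otimes>\<^sub>M borel) \<and> partition_on E R"

text \<open>
  Depends on the invariant measure only through its disintegration \<open>\<kappa>\<close>.
\<close>

definition relative_entropy ::
    "'w measure \<Rightarrow> ('w \<Rightarrow> 'w) \<Rightarrow> ('w \<times> 'x :: topological_space) set \<Rightarrow> ('w \<Rightarrow> 'x \<Rightarrow> 'x)
      \<Rightarrow> ('w \<Rightarrow> 'x measure) \<Rightarrow> ennreal" where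
  "relative_entropy P \<theta> E f \<kappa> =
    (SUP R \<in> {R. finite_measurable_partition P E R}. partition_relative_entropy P \<theta> E f \<kappa> R)"

definition Gamma_plus ::
    "('w \<Rightarrow> 'w) \<Rightarrow> ('w \<times> 'x :: metric_space) set \<Rightarrow> ('w \<Rightarrow> 'x \<Rightarrow> 'x) \<Rightarrow> ('w \<Rightarrow> real)
      \<Rightarrow> 'x \<Rightarrow> 'w \<Rightarrow> 'x set" where
  "Gamma_plus \<theta> E f \<delta> x w =
    {y \<in> fiber E w. \<forall>k. dist (cocycle \<theta> f k w x) (cocycle \<theta> f k w y) \<le> \<delta> ((\<theta> ^^ k) w)}"

definition stable_class ::
    "('w \<Rightarrow> 'w) \<Rightarrow> ('w \<times> 'x :: metric_space) set \<Rightarrow> ('w \<Rightarrow> 'x \<Rightarrow> 'x) \<Rightarrow> 'w \<Rightarrow> 'x \<Rightarrow> 'x set" where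
  "stable_class \<theta> E f w p =
    {x \<in> fiber E w. (\<lambda>n. dist (cocycle \<theta> f n w x) (cocycle \<theta> f n w p)) \<longlonglongrightarrow> 0}"

text \<open>
  Measure zero is expressed by \<^const>\<open>null_sets\<close>: \<^const>\<open>emeasure\<close> is 0 on every non-measurable
  set, so an equation \<open>emeasure (\<kappa> w) A = 0\<close> would not assert measurability of \<open>A\<close>.
\<close>

definition positively_random_expansive ::
    "'w measure \<Rightarrow> ('w \<Rightarrow> 'w) \<Rightarrow> ('w \<times> 'x :: metric_space) set \<Rightarrow> ('w \<Rightarrow> 'x \<Rightarrow> 'x)
      \<Rightarrow> ('w \<Rightarrow> 'x measure) \<Rightarrow> bool" where
  "positively_random_expansive P \<theta> E f \<kappa> \<longleftrightarrow>
    (\<exists>\<delta> \<in> borel_measurable P. (\<forall>w. 0 < \<delta> w) \<and>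
      (AE w in P. \<forall>x \<in> fiber E w. Gamma_plus \<theta> E f \<delta> x w \<in> null_sets (\<kappa> w)))"

end

theory Submission
  imports Defs
begin

text \<open>
  The idea is to count itineraries. Fix a finite measurable partition \<open>R\<close> of \<open>E\<close> with positive
  relative entropy. Two quantities compete in a fibre: the mass of the cells of the \<open>n\<close>-th join of
  \<open>R\<close>, which is exponentially small along infinitely many \<open>n\<close> because the entropy is positive, and
  the number of such cells that a dynamical ball can meet, which grows at an arbitrarily small
  exponential rate. Hence dynamical balls are null.

  The first part (lemma \<open>AE_small_cells_infinitely_often\<close>) is a weak form of the
  Shannon-McMillan-Breiman theorem. If, for every \<open>c > 0\<close>, almost every point were eventually in
  cells of mass at least \<open>exp (- c * n)\<close>, then the entropies of the joins would grow sublinearly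
  and the relative entropy of \<open>R\<close> would vanish. So for some \<open>c\<close> the cells of the points of a set of
  positive measure are smaller infinitely often, and ergodicity, together with the equivariance of
  the fibre measures (lemma \<open>kernel_equivariant\<close>), spreads this to almost every point.

  For the second part, inner regularity on the Polish product space provides compact subsets of the
  elements of \<open>R\<close> that leave out only a set \<open>B\<close> of small measure (lemma \<open>separated_cores\<close>). They have
  positive distance from each other, and any smaller number serves as a constant radius \<open>\<delta>\<close>: two
  points of a fibre that stay \<open>\<delta>\<close>-close have the same symbol whenever neither of them visits \<open>B\<close>.
  Visits to \<open>B\<close> have small upper frequency, by the maximal inequality and ergodicity (lemma
  \<open>AE_visits_linear_bound\<close>), so the itineraries that occur lie in a Hamming ball of small relative
  radius, which has few words (lemma \<open>card_hamming_ball\<close>). Summing masses over the ball and applying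
  the Borel-Cantelli lemma finishes the argument for typical centres (lemma \<open>tail_ball_null\<close>);
  halving the radius extends it to all centres.

  All this is insensitive to finitely many initial times. It therefore applies to the set of points
  that are \<open>\<delta>\<close>-close to \<open>p\<close> from time \<open>m\<close> on, and the stable class of \<open>p\<close> is contained in the union
  of these sets over \<open>m\<close>, which gives the second claim.
\<close>

section \<open>Ergodic measure-preserving systems\<close>

text \<open>
  The general theory is developed for a total measurable self-map; the skew product is extended to
  one further below.
\<close>

locale ergodic_system = prob_space M for M :: "'a measure" +
  fixes T :: "'a \<Rightarrow> 'a"
  assumes T_measurable [measurable]: "T \<in> M \<rightarrow>\<^sub>M M"
    and T_preserving: "distr M M T = M"
    and ergodic: "\<And>A. A \<in> sets M \<Longrightarrow> T -` A \<inter> space M = A \<Longrightarrow> prob A = 0 \<or> prob A = 1"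
begin

lemma iterate_measurable [measurable]: "(T ^^ n) \<in> M \<rightarrow>\<^sub>M M"
  by (induction n) (auto intro: measurable_comp simp: id_def[symmetric])

lemma iterate_preserving: "distr M M (T ^^ n) = M"
proof (induction n)
  case 0
  show ?case by (simp add: distr_id id_def)
next
  case (Suc n)
  have "distr M M (T ^^ Suc n) = distr (distr M M (T ^^ n)) M T"
    by (subst distr_distr) auto
  then show ?case
    by (simp only: Suc T_preserving)
qed

lemma prob_iterate_vimage:
  assumes "A \<in> sets M"
  shows "prob ((T ^^ n) -` A \<inter> space M) = prob A"
  using measure_distr[OF iterate_measurable assms, of n] by (simp add: iterate_preserving)

text \<open>
  The set of points that visit \<open>A\<close> at arbitrarily late times is strictly invariant, so ergodicity
  applies to it even though it is stated for strictly invariant sets only. Its probability is at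
  least that of \<open>A\<close>, because each set of points with a visit after time \<open>N\<close> contains an iterated
  preimage of \<open>A\<close>.
\<close>

lemma AE_visits_positive_prob_set:
  assumes A [measurable]: "A \<in> sets M" and pos: "prob A > 0"
  shows "AE x in M. \<exists>k. (T ^^ k) x \<in> A"
proof -
  define U where "U N = {x \<in> space M. \<exists>k\<ge>N. (T ^^ k) x \<in> A}" for N
  have U [measurable]: "U N \<in> sets M" for N
    unfolding U_def by measurable
  have U_ge: "prob A \<le> prob (U N)" for N
  proof -
    have "(T ^^ N) -` A \<inter> space M \<subseteq> U N"
      by (auto simp: U_def)
    then show ?thesis
      using prob_iterate_vimage[OF A, of N] finite_measure_mono[of _ "U N"] U by metis
  qed
  have dec: "decseq U"
    by (auto simp: decseq_def U_def intro: order_trans)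
  have T_space: "T x \<in> space M" if "x \<in> space M" for x
    using that measurable_space[OF T_measurable] by blast
  have shift: "T x \<in> U N \<longleftrightarrow> x \<in> U (Suc N)" if "x \<in> space M" for x N
  proof -
    have "(\<exists>k\<ge>N. (T ^^ k) (T x) \<in> A) \<longleftrightarrow> (\<exists>k\<ge>Suc N. (T ^^ k) x \<in> A)"
      by (metis Suc_le_D Suc_le_mono funpow_Suc_right o_apply)
    then show ?thesis
      using that T_space by (auto simp: U_def)
  qed
  have "T -` (\<Inter>N. U N) \<inter> space M = (\<Inter>N. U N)"
  proof (intro equalityI subsetI)
    fix x assume "x \<in> T -` (\<Inter>N. U N) \<inter> space M"
    then have "x \<in> U (Suc N)" for N using shift by blast
    then show "x \<in> (\<Inter>N. U N)" using dec by (auto simp: decseq_Suc_iff)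
  next
    fix x assume x: "x \<in> (\<Inter>N. U N)"
    then have "x \<in> space M" by (auto simp: U_def)
    then show "x \<in> T -` (\<Inter>N. U N) \<inter> space M" using x shift by blast
  qed
  then have "prob (\<Inter>N. U N) = 0 \<or> prob (\<Inter>N. U N) = 1"
    by (intro ergodic) auto
  moreover have "prob A \<le> prob (\<Inter>N. U N)"
  proof (rule LIMSEQ_le_const)
    show "(\<lambda>N. prob (U N)) \<longlonglongrightarrow> prob (\<Inter>N. U N)"
      using U dec by (intro finite_Lim_measure_decseq) auto
  qed (use U_ge in blast)
  ultimately have "prob (\<Inter>N. U N) = 1"
    using pos by linarith
  then have "AE x in M. x \<in> (\<Inter>N. U N)"
    by (intro AE_in_set_eq_1[THEN iffD2]) auto
  then show ?thesis
    by (rule AE_mp) (auto simp: U_def intro!: AE_I2)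
qed

definition visits :: "'a set \<Rightarrow> nat \<Rightarrow> 'a \<Rightarrow> nat" where
  "visits B n x = card {i. i < n \<and> (T ^^ i) x \<in> B}"

lemma visits_sum: "real (visits B n x) = (\<Sum>i<n. indicator B ((T ^^ i) x))"
proof -
  have "(\<Sum>i<n. indicator B ((T ^^ i) x) :: real) = (\<Sum>i<n. if i \<in> {i. (T ^^ i) x \<in> B} then 1 else 0)"
    by (intro sum.cong) (auto simp: indicator_def)
  also have "\<dots> = card ({..<n} \<inter> {i. (T ^^ i) x \<in> B})"
    by (subst sum.If_cases) auto
  also have "{..<n} \<inter> {i. (T ^^ i) x \<in> B} = {i. i < n \<and> (T ^^ i) x \<in> B}"
    by auto
  finally show ?thesis
    by (simp add: visits_def)
qed

lemma visits_measurable [measurable]: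
  assumes [measurable]: "B \<in> sets M"
  shows "(\<lambda>x. real (visits B n x)) \<in> borel_measurable M"
  unfolding visits_sum by measurable

lemma visits_Suc_left: "visits B (Suc n) x = (if x \<in> B then 1 else 0) + visits B n (T x)"
proof -
  have "real (visits B (Suc n) x) = real ((if x \<in> B then 1 else 0) + visits B n (T x))"
    unfolding visits_sum sum.lessThan_Suc_shift of_nat_add
    by (simp add: funpow_swap1 visits_sum flip: of_nat_sum) 
  then show ?thesis
    by linarith
qed

lemma visits_iterate: "visits B n x \<le> k + visits B n ((T ^^ k) x)"
proof (induction k arbitrary: x)
  case (Suc k)
  have "visits B n x \<le> visits B (Suc n) x"
    unfolding visits_def by (intro card_mono) auto
  also have "\<dots> \<le> Suc (visits B n (T x))"
    by (simp add: visits_Suc_left)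
  also have "\<dots> \<le> Suc (k + visits B n ((T ^^ k) (T x)))"
    using Suc[of "T x"] by simp
  finally show ?case
    by (simp add: funpow_swap1)
qed simp

text \<open>
  This is the maximum over \<open>k \<le> n\<close> of the number of visits to \<open>B\<close> before time \<open>k\<close>, minus
  \<open>\<epsilon> * k\<close>. The recursion peels off the first step of the orbit, which is exactly the form that the
  maximal inequality uses.
\<close>

fun max_excess :: "'a set \<Rightarrow> real \<Rightarrow> nat \<Rightarrow> 'a \<Rightarrow> real" where
  "max_excess B \<epsilon> 0 x = 0"
| "max_excess B \<epsilon> (Suc n) x = max 0 (indicator B x - \<epsilon> + max_excess B \<epsilon> n (T x))"

lemma max_excess_nonneg: "0 \<le> max_excess B \<epsilon> n x"
  by (cases n) auto

lemma max_excess_mono: "max_excess B \<epsilon> n x \<le> max_excess B \<epsilon> (Suc n) x"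
proof (induction n arbitrary: x)
  case (Suc n)
  show ?case using Suc[of "T x"] by simp
qed simp

lemma max_excess_le: "0 \<le> \<epsilon> \<Longrightarrow> max_excess B \<epsilon> n x \<le> real n"
proof (induction n arbitrary: x)
  case (Suc n)
  show ?case using Suc.IH[of "T x"] Suc.prems by (auto simp: indicator_def)
qed simp

lemma max_excess_measurable [measurable]:
  assumes [measurable]: "B \<in> sets M"
  shows "max_excess B \<epsilon> n \<in> borel_measurable M"
proof (induction n)
  case (Suc n)
  note [measurable] = Suc
  show ?case by (simp del: of_nat_Suc)
qed simp

lemma visits_le_max_excess:
  fixes \<epsilon> :: real
  shows "real (visits B n x) - \<epsilon> * n \<le> max_excess B \<epsilon> n x"
proof (induction n arbitrary: x)
  case 0
  then show ?case by (simp add: visits_def)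
next
  case (Suc n)
  show ?case
    using Suc[of "T x"] by (auto simp: visits_Suc_left indicator_def algebra_simps)
qed

text \<open>
  Garsia's argument: where the maximal excess \<open>m\<close> is positive, \<open>m - m \<circ> T\<close> is at most
  \<open>indicator B - \<epsilon>\<close>, and elsewhere it is not positive; the integral of
  \<open>m - m \<circ> T\<close> vanishes by invariance.
\<close>

lemma maximal_inequality:
  assumes B [measurable]: "B \<in> sets M" and \<epsilon>: "0 \<le> \<epsilon>"
  shows "\<epsilon> * prob {x \<in> space M. 0 < max_excess B \<epsilon> n x} \<le> prob B"
proof -
  let ?m = "max_excess B \<epsilon> n" and ?G = "{x \<in> space M. 0 < max_excess B \<epsilon> n x}"
  let ?g = "\<lambda>x. indicator B x - \<epsilon>"
  have G [measurable]: "?G \<in> sets M" by measurable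
  have [simp]: "integrable M ?m"
    using max_excess_nonneg[of B \<epsilon> n] max_excess_le[OF \<epsilon>, of B n]
    by (intro integrable_const_bound[where B = "real n"]) auto
  have [simp]: "integrable M (\<lambda>x. ?m (T x))"
    using max_excess_nonneg[of B \<epsilon> n] max_excess_le[OF \<epsilon>, of B n]
    by (intro integrable_const_bound[where B = "real n"]) auto
  have "(\<integral>x. ?m (T x) \<partial>M) = (\<integral>x. ?m x \<partial>distr M M T)"
    by (subst integral_distr) auto
  then have "0 = (\<integral>x. ?m x - ?m (T x) \<partial>M)"
    by (simp add: T_preserving)
  also have "\<dots> \<le> (\<integral>x. indicator (B \<inter> ?G) x - \<epsilon> * indicator ?G x \<partial>M)"
  proof (intro integral_mono_AE AE_I2)
    fix x assume x: "x \<in> space M"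
    \<comment> \<open>Only the monotonicity in the length turns the recursion for length \<open>n + 1\<close> into one for \<open>n\<close>.\<close>
    have "?m x \<le> max 0 (?g x + ?m (T x))"
      using max_excess_mono[of B \<epsilon> n x] by simp
    then show "?m x - ?m (T x) \<le> indicator (B \<inter> ?G) x - \<epsilon> * indicator ?G x"
      using x max_excess_nonneg[of B \<epsilon> n x] max_excess_nonneg[of B \<epsilon> n "T x"]
      by (auto simp: indicator_def split: if_splits)
  qed (auto intro!: integrable_real_indicator simp: emeasure_eq_measure)
  also have "\<dots> = prob (B \<inter> ?G) - \<epsilon> * prob ?G"
    by (subst Bochner_Integration.integral_diff)
       (auto intro!: integrable_real_indicator simp: emeasure_eq_measure)
  also have "\<dots> \<le> prob B - \<epsilon> * prob ?G"
    by (simp add: finite_measure_mono)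
  finally show ?thesis by simp
qed

text \<open>
  The upper half of the ergodic theorem for visits to \<open>B\<close>, up to an arbitrarily small loss in the
  frequency. By the maximal inequality the points that never exceed the frequency \<open>\<epsilon>\<close> have positive
  probability. Almost every orbit enters this set, and the time before it enters is absorbed in \<open>N\<close>.
\<close>

lemma AE_visits_linear_bound:
  assumes B [measurable]: "B \<in> sets M" and less: "prob B < \<epsilon>"
  shows "AE x in M. \<exists>N. \<forall>n. real (visits B n x) \<le> real N + \<epsilon> * real n"
proof -
  have \<epsilon>: "0 < \<epsilon>" using less measure_nonneg[of M B] by linarith
  define G where "G n = {x \<in> space M. 0 < max_excess B \<epsilon> n x}" for n
  have G [measurable]: "G n \<in> sets M" for n unfolding G_def by measurable
  have "incseq G"
    by (rule incseq_SucI)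
      (auto simp: G_def simp del: max_excess.simps intro: less_le_trans[OF _ max_excess_mono])
  then have "(\<lambda>n. prob (G n)) \<longlonglongrightarrow> prob (\<Union>n. G n)"
    by (intro finite_Lim_measure_incseq) auto
  moreover have "prob (G n) \<le> prob B / \<epsilon>" for n
    using maximal_inequality[OF B, of \<epsilon> n] \<epsilon> by (simp add: G_def field_simps)
  ultimately have "prob (\<Union>n. G n) \<le> prob B / \<epsilon>"
    by (intro LIMSEQ_le_const2) auto
  then have "prob (\<Union>n. G n) < 1"
    using less \<epsilon> by (simp add: divide_less_eq_1 le_less_trans)
  then have "prob (space M - (\<Union>n. G n)) > 0"
    by (subst prob_compl) auto
  then have "AE x in M. \<exists>k. (T ^^ k) x \<in> space M - (\<Union>n. G n)"
    by (intro AE_visits_positive_prob_set) auto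
  then show ?thesis
  proof (rule AE_mp, intro AE_I2 impI)
    fix x assume "\<exists>k. (T ^^ k) x \<in> space M - (\<Union>n. G n)"
    then obtain k where k: "(T ^^ k) x \<in> space M - (\<Union>n. G n)" by blast
    have "real (visits B n x) \<le> real k + \<epsilon> * real n" for n
    proof -
      have "max_excess B \<epsilon> n ((T ^^ k) x) \<le> 0"
        using k by (auto simp: G_def not_less)
      then have "real (visits B n ((T ^^ k) x)) \<le> \<epsilon> * n"
        using visits_le_max_excess[where x = "(T ^^ k) x" and B = B and n = n and \<epsilon> = \<epsilon>] by linarith
      then show ?thesis
        using visits_iterate[where k = k and x = x and B = B and n = n] by linarith
    qed
    then show "\<exists>N. \<forall>n. real (visits B n x) \<le> real N + \<epsilon> * real n" by blast
  qed
qed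

end

section \<open>Words in a Hamming ball\<close>

text \<open>
  The generating function of the Hamming distance to \<open>a\<close> factorises over the letters; each factor is
  \<open>1 + (card S - 1) * t\<close>. With a small \<open>t\<close> this gives an exponential bound for Hamming balls that
  avoids estimates of binomial coefficients.
\<close>

lemma hamming_weight_sum:
  fixes t :: real and n :: nat
  assumes S: "finite S" and a: "\<And>i. i < n \<Longrightarrow> a i \<in> S" and t: "0 \<le> t"
  shows "(\<Sum>b \<in> {..<n} \<rightarrow>\<^sub>E S. t ^ card {i. i < n \<and> b i \<noteq> a i}) \<le> exp (card S * t * n)"
proof -
  have "(\<Sum>b \<in> {..<n} \<rightarrow>\<^sub>E S. t ^ card {i. i < n \<and> b i \<noteq> a i})
      = (\<Sum>b \<in> {..<n} \<rightarrow>\<^sub>E S. \<Prod>i<n. if b i \<noteq> a i then t else 1)"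
  proof (intro sum.cong refl)
    fix b
    have "(\<Prod>i<n. if b i \<noteq> a i then t else 1) = (\<Prod>i \<in> {..<n} \<inter> {i. b i \<noteq> a i}. t)"
      by (subst prod.If_cases) auto
    also have "{..<n} \<inter> {i. b i \<noteq> a i} = {i. i < n \<and> b i \<noteq> a i}" by auto
    finally show "t ^ card {i. i < n \<and> b i \<noteq> a i} = (\<Prod>i<n. if b i \<noteq> a i then t else 1)"
      by simp
  qed
  also have "\<dots> = (\<Prod>i<n. \<Sum>s\<in>S. if s \<noteq> a i then t else 1)"
    by (subst prod_sum_PiE) (auto simp: S)
  also have "\<dots> \<le> (\<Prod>i<n. exp (card S * t))"
  proof (intro prod_mono conjI)
    fix i assume "i \<in> {..<n}"
    then have ai: "a i \<in> S" using a by simp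
    show "0 \<le> (\<Sum>s\<in>S. if s \<noteq> a i then t else 1)"
      using t by (intro sum_nonneg) auto
    have "(\<Sum>s\<in>S. if s \<noteq> a i then t else 1) = 1 + (\<Sum>s\<in>S - {a i}. t)"
      using S ai by (subst sum.remove[of _ "a i"]) (auto intro!: sum.cong)
    also have "\<dots> \<le> 1 + card S * t"
      using S t by (auto intro!: mult_right_mono card_mono)
    also have "\<dots> \<le> exp (card S * t)"
      by (rule exp_ge_add_one_self)
    finally show "(\<Sum>s\<in>S. if s \<noteq> a i then t else 1) \<le> exp (card S * t)" .
  qed
  also have "\<dots> = exp (card S * t * n)"
    by (simp add: exp_of_nat2_mult)
  finally show ?thesis .
qed

lemma card_hamming_ball:
  fixes t d :: real and n :: nat
  assumes S: "finite S" and a: "\<And>i. i < n \<Longrightarrow> a i \<in> S" and t: "0 < t" "t \<le> 1"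
  shows "card {b \<in> {..<n} \<rightarrow>\<^sub>E S. card {i. i < n \<and> b i \<noteq> a i} \<le> d}
    \<le> exp (card S * t * n + d * ln (1 / t))"
proof -
  let ?C = "{b \<in> {..<n} \<rightarrow>\<^sub>E S. card {i. i < n \<and> b i \<noteq> a i} \<le> d}"
  have "card ?C * t powr d = (\<Sum>b\<in>?C. t powr d)" by simp
  also have "\<dots> \<le> (\<Sum>b\<in>?C. t ^ card {i. i < n \<and> b i \<noteq> a i})"
  proof (intro sum_mono)
    fix b assume "b \<in> ?C"
    then have "t powr d \<le> t powr real (card {i. i < n \<and> b i \<noteq> a i})"
      using t by (intro powr_mono') auto
    then show "t powr d \<le> t ^ card {i. i < n \<and> b i \<noteq> a i}"
      using t by (simp add: powr_realpow)
  qed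
  also have "\<dots> \<le> (\<Sum>b \<in> {..<n} \<rightarrow>\<^sub>E S. t ^ card {i. i < n \<and> b i \<noteq> a i})"
    using S t by (intro sum_mono2) (auto intro!: finite_PiE)
  also have "\<dots> \<le> exp (card S * t * n)"
    using t by (intro hamming_weight_sum S a) auto
  finally have "card ?C \<le> exp (card S * t * n) / t powr d"
    using t by (simp add: field_simps)
  also have "\<dots> = exp (card S * t * n + d * ln (1 / t))"
    using t by (simp add: powr_def ln_div exp_diff)
  finally show ?thesis .
qed

section \<open>Entropy of a finite partition\<close>

text \<open>
  Gibbs' inequality for a single term, compared with the weight \<open>exp (- L)\<close>.
\<close>

lemma entropy_term_le:
  fixes m L :: real
  assumes "0 \<le> m"
  shows "- (m * ln m) \<le> m * L + exp (- L)"
proof (cases "m = 0")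
  case False
  with assms have m: "0 < m" by simp
  have "- ln (m * exp L) \<le> 1 / (m * exp L) - 1"
    using m ln_le_minus_one[of "1 / (m * exp L)"] by (simp add: ln_div)
  then have "m * (- ln m - L) \<le> m * (1 / (m * exp L) - 1)"
    using m by (intro mult_left_mono) (auto simp: ln_mult)
  also have "\<dots> \<le> exp (- L)"
    using m by (simp add: field_simps exp_minus)
  finally show ?thesis by (simp add: algebra_simps)
qed simp

text \<open>
  Cells of mass at least \<open>exp (- a)\<close> contribute at most \<open>a\<close> in total. The others lie in \<open>B\<close>, and
  comparing each of them with \<open>1 / k\<close> bounds their contribution by \<open>ln k\<close> times the mass of \<open>B\<close>, up
  to the additive error \<open>1\<close>.
\<close>

lemma partition_entropy_le:
  assumes "prob_space m" and fin: "finite \<A>" and meas: "\<A> \<subseteq> sets m" and disj: "disjoint \<A>"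
    and card: "card \<A> \<le> k" and k: "1 \<le> k" and a: "0 \<le> a"
    and B: "B \<in> sets m" "\<And>A. A \<in> \<A> \<Longrightarrow> measure m A < exp (- a) \<Longrightarrow> A \<subseteq> B"
  shows "partition_entropy m \<A> \<le> ennreal (a + ln k * measure m B + 1)"
proof -
  interpret prob_space m by fact
  let ?L = "\<A> \<inter> {A. prob A < exp (- a)}" and ?H = "\<A> \<inter> - {A. prob A < exp (- a)}"
  have sum_prob: "(\<Sum>A\<in>\<C>. prob A) = prob (\<Union>\<C>)" if "\<C> \<subseteq> \<A>" for \<C>
  proof -
    have "pairwise disjnt \<C>"
      using disj that by (rule pairwise_subset)
    moreover have "finite \<C>"
      using that fin by (rule finite_subset)
    ultimately show ?thesis
      using that meas by (subst measure_Union') (auto simp: fmeasurable_eq_sets)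
  qed
  have low: "(\<Sum>A\<in>?L. - (prob A * ln (prob A))) \<le> ln k * prob B + 1"
  proof -
    have "(\<Sum>A\<in>?L. - (prob A * ln (prob A))) \<le> (\<Sum>A\<in>?L. prob A * ln k + exp (- ln k))"
      by (intro sum_mono entropy_term_le) auto
    also have "\<dots> = ln k * prob (\<Union>?L) + card ?L / k"
      using k by (simp add: sum.distrib sum_prob exp_minus divide_inverse flip: sum_distrib_right)
    also have "\<dots> \<le> ln k * prob B + 1"
    proof (intro add_mono mult_left_mono finite_measure_mono)
      show "\<Union>?L \<subseteq> B" using B(2) by blast
      have "card ?L \<le> k"
        using card_mono[OF fin, of ?L] card by auto
      then show "card ?L / k \<le> 1" using k by simp
    qed (use k B in auto)
    finally show ?thesis .
  qed
  have high: "(\<Sum>A\<in>?H. - (prob A * ln (prob A))) \<le> a"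
  proof -
    have "(\<Sum>A\<in>?H. - (prob A * ln (prob A))) \<le> (\<Sum>A\<in>?H. prob A * a)"
    proof (intro sum_mono)
      fix A assume "A \<in> ?H"
      then have "exp (- a) \<le> prob A" by (simp add: not_less)
      then have "- a \<le> ln (prob A)"
        by (metis exp_gt_zero less_le_trans ln_exp ln_le_cancel_iff)
      then have "prob A * (- ln (prob A)) \<le> prob A * a"
        by (intro mult_left_mono) auto
      then show "- (prob A * ln (prob A)) \<le> prob A * a" by simp
    qed
    also have "\<dots> = prob (\<Union>?H) * a"
      by (simp add: sum_prob flip: sum_distrib_right)
    also have "\<dots> \<le> 1 * a"
      by (intro mult_right_mono a) auto
    finally show ?thesis by simp
  qed
  have "partition_entropy m \<A> = (\<Sum>A\<in>\<A>. ennreal (- (prob A * ln (prob A))))"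
    unfolding partition_entropy_def by (rule nn_integral_count_space_finite[OF fin])
  also have "\<dots> = ennreal (\<Sum>A\<in>\<A>. - (prob A * ln (prob A)))"
  proof (intro sum_ennreal)
    fix A
    have "ln (prob A) \<le> 0" if "prob A \<noteq> 0"
      using that measure_nonneg[of m A] by (intro ln_le_zero_iff[THEN iffD2]) (auto simp: less_le)
    then show "0 \<le> - (prob A * ln (prob A))"
      by (cases "prob A = 0") (simp_all add: mult_nonneg_nonpos)
  qed
  also have "(\<Sum>A\<in>\<A>. - (prob A * ln (prob A)))
      = (\<Sum>A\<in>?L. - (prob A * ln (prob A))) + (\<Sum>A\<in>?H. - (prob A * ln (prob A)))"
    by (subst sum.Int_Diff[OF fin, of _ "{A. prob A < exp (- a)}"]) (simp add: Diff_eq)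
  finally show ?thesis
    using low high by (auto intro: ennreal_leI)
qed

section \<open>The skew product as an ergodic system, and its fibre measures\<close>

lemma fiber_iff [simp]: "x \<in> fiber C w \<longleftrightarrow> (w, x) \<in> C"
  by (simp add: fiber_def)

locale ergodic_rds = bundle_rds P \<theta> E f
  for P :: "'w :: polish_space measure"
    and \<theta> :: "'w \<Rightarrow> 'w"
    and E :: "('w \<times> 'x :: polish_space) set"
    and f :: "'w \<Rightarrow> 'x \<Rightarrow> 'x" +
  fixes \<mu> :: "('w \<times> 'x) measure" and \<kappa> :: "'w \<Rightarrow> 'x measure"
  assumes invariant: "\<mu> \<in> invariant_measures P \<theta> E f"
    and ergodic_mu: "ergodic_measure \<theta> E f \<mu>"
    and disint: "disintegration P E \<mu> \<kappa>"
begin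

lemma space_base [simp]: "space P = UNIV"
  using sets_eq_imp_space_eq[OF sets_base] by simp

lemma sets_mu [measurable_cong]: "sets \<mu> = sets (P \<Otimes>\<^sub>M borel)"
  using invariant by (simp add: invariant_measures_def bundle_measures_def)

lemma space_mu [simp]: "space \<mu> = UNIV"
  using sets_eq_imp_space_eq[OF sets_mu] by (simp add: space_pair_measure)

lemma sets_mu_borel: "sets \<mu> = sets borel"
  unfolding sets_mu sets_pair_measure_cong[OF sets_base refl] borel_prod ..

lemma mu_prob_space: "prob_space \<mu>"
  using invariant by (simp add: invariant_measures_def bundle_measures_def)

lemma E_sets [measurable]: "E \<in> sets \<mu>"
  using bundle_sets sets_mu by simp

lemma E_sets_pair [measurable]: "E \<in> sets (P \<Otimes>\<^sub>M borel)"
  by (rule bundle_sets)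

lemma marginal: "distr \<mu> P fst = P"
  using invariant by (simp add: invariant_measures_def bundle_measures_def)

lemma AE_mu_E: "AE z in \<mu>. z \<in> E"
proof -
  interpret mu: prob_space \<mu> by (rule mu_prob_space)
  have "emeasure \<mu> E = 1"
    using invariant by (simp add: invariant_measures_def bundle_measures_def)
  then show ?thesis
    by (intro mu.AE_in_set_eq_1[THEN iffD2]) (auto simp: measure_def)
qed

lemma AE_fst:
  assumes "AE w in P. Q w"
  shows "AE z in \<mu>. Q (fst z)"
proof -
  have "fst \<in> \<mu> \<rightarrow>\<^sub>M P" by measurable
  moreover have "AE w in distr \<mu> P fst. Q w" using assms unfolding marginal .
  ultimately show ?thesis by (rule AE_distrD)
qed

text \<open>
  The identity outside \<open>E\<close> makes the skew product a measurable self-map of the whole product space;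
  since \<open>\<mu>\<close> is carried by \<open>E\<close>, this changes neither invariance nor ergodicity.
\<close>

definition T :: "'w \<times> 'x \<Rightarrow> 'w \<times> 'x" where
  "T z = (if z \<in> E then skew_product \<theta> f z else z)"

lemma T_in_E_iff [simp]: "T z \<in> E \<longleftrightarrow> z \<in> E"
  using fiber_map[of "snd z" "fst z"] by (cases z) (auto simp: T_def skew_product_def)

lemma iterate_in_E_iff [simp]: "(T ^^ k) z \<in> E \<longleftrightarrow> z \<in> E"
  by (induction k) auto

lemma iterate_eq: "(w, x) \<in> E \<Longrightarrow> (T ^^ k) (w, x) = ((\<theta> ^^ k) w, cocycle \<theta> f k w x)"
proof (induction k)
  case (Suc k)
  then have "((\<theta> ^^ k) w, cocycle \<theta> f k w x) \<in> E"
    using iterate_in_E_iff[of k "(w, x)"] by simp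
  then show ?case
    using Suc by (simp add: T_def skew_product_def)
qed simp

lemma fst_iterate: "z \<in> E \<Longrightarrow> fst ((T ^^ k) z) = (\<theta> ^^ k) (fst z)"
  by (cases z) (simp add: iterate_eq)

lemma iterate_eq_skew_product: "z \<in> E \<Longrightarrow> (skew_product \<theta> f ^^ k) z = (T ^^ k) z"
proof (induction k)
  case (Suc k)
  then show ?case using iterate_in_E_iff[of k z] by (simp add: T_def[of "(T ^^ k) z"])
qed simp

lemma T_measurable: "T \<in> \<mu> \<rightarrow>\<^sub>M \<mu>"
proof -
  have "(\<lambda>z. (\<theta> (fst z), f (fst z) (snd z))) \<in> restrict_space (P \<Otimes>\<^sub>M borel) E \<rightarrow>\<^sub>M P \<Otimes>\<^sub>M borel"
  proof (rule measurable_Pair)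
    show "(\<lambda>z. \<theta> (fst z)) \<in> restrict_space (P \<Otimes>\<^sub>M borel) E \<rightarrow>\<^sub>M P"
      by (intro measurable_restrict_space1 measurable_compose[OF measurable_fst base_measurable])
    show "(\<lambda>z. f (fst z) (snd z)) \<in> restrict_space (P \<Otimes>\<^sub>M borel) E \<rightarrow>\<^sub>M borel"
      using map_measurable by (simp add: case_prod_beta')
  qed
  then have "(\<lambda>z. if z \<in> E then skew_product \<theta> f z else z) \<in> P \<Otimes>\<^sub>M borel \<rightarrow>\<^sub>M P \<Otimes>\<^sub>M borel"
    by (subst measurable_If_restrict_space_iff)
       (auto simp: skew_product_def case_prod_beta' intro: measurable_restrict_space1)
  then have "T \<in> P \<Otimes>\<^sub>M borel \<rightarrow>\<^sub>M P \<Otimes>\<^sub>M borel"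
    by (simp add: T_def[abs_def])
  then show ?thesis
    by (simp cong: measurable_cong_sets add: measurable_cong_sets[OF sets_mu sets_mu])
qed

lemma T_preserving: "distr \<mu> \<mu> T = \<mu>"
proof (rule measure_eqI)
  fix A assume "A \<in> sets (distr \<mu> \<mu> T)"
  then have A [measurable]: "A \<in> sets \<mu>" by simp
  note [measurable] = T_measurable
  have TA [measurable]: "T -` A \<in> sets \<mu>"
    using measurable_sets[OF T_measurable A] by simp
  have "emeasure (distr \<mu> \<mu> T) A = emeasure \<mu> (T -` A)"
    by (subst emeasure_distr) auto
  also have "\<dots> = emeasure \<mu> (E \<inter> skew_product \<theta> f -` (A \<inter> E))"
  proof (rule emeasure_eq_AE)
    have eq: "E \<inter> skew_product \<theta> f -` (A \<inter> E) = E \<inter> T -` A"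
    proof (intro set_eqI)
      fix z show "z \<in> E \<inter> skew_product \<theta> f -` (A \<inter> E) \<longleftrightarrow> z \<in> E \<inter> T -` A"
        using T_in_E_iff[of z] by (auto simp: T_def)
    qed
    then show "E \<inter> skew_product \<theta> f -` (A \<inter> E) \<in> sets \<mu>" by simp
    show "AE z in \<mu>. z \<in> T -` A \<longleftrightarrow> z \<in> E \<inter> skew_product \<theta> f -` (A \<inter> E)"
      unfolding eq using AE_mu_E by eventually_elim auto
  qed auto
  also have "\<dots> = emeasure \<mu> (A \<inter> E)"
    using invariant by (auto simp: invariant_measures_def)
  also have "\<dots> = emeasure \<mu> A"
    using AE_mu_E by (intro emeasure_eq_AE) (auto elim: eventually_mono)
  finally show "emeasure (distr \<mu> \<mu> T) A = emeasure \<mu> A" .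
qed simp

sublocale mu: ergodic_system \<mu> T
proof -
  interpret mu: prob_space \<mu> by (rule mu_prob_space)
  show "ergodic_system \<mu> T"
  proof
    fix A assume A [measurable]: "A \<in> sets \<mu>" and inv: "T -` A \<inter> space \<mu> = A"
    have "E \<inter> skew_product \<theta> f -` (A \<inter> E) = A \<inter> E"
    proof (intro set_eqI)
      fix z
      have "T z \<in> A \<longleftrightarrow> z \<in> A" using inv by auto
      then show "z \<in> E \<inter> skew_product \<theta> f -` (A \<inter> E) \<longleftrightarrow> z \<in> A \<inter> E"
        using T_in_E_iff[of z] by (auto simp: T_def)
    qed
    then have "emeasure \<mu> (A \<inter> E) = 0 \<or> emeasure \<mu> (A \<inter> E) = 1"
      using ergodic_mu by (auto simp: ergodic_measure_def)
    moreover have "emeasure \<mu> (A \<inter> E) = emeasure \<mu> A"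
      using AE_mu_E by (intro emeasure_eq_AE) (auto elim: eventually_mono)
    ultimately show "measure \<mu> A = 0 \<or> measure \<mu> A = 1"
      by (auto simp: measure_def)
  qed (fact T_measurable T_preserving)+
qed

lemma kernel_measurable: "\<kappa> \<in> P \<rightarrow>\<^sub>M prob_algebra borel"
  using disint by (simp add: disintegration_def)

lemma kernel_prob_space: "prob_space (\<kappa> w)"
  and sets_kernel [simp, measurable_cong]: "sets (\<kappa> w) = sets borel"
  using measurable_space[OF kernel_measurable, of w] by (auto simp: space_prob_algebra)

lemma space_kernel [simp]: "space (\<kappa> w) = UNIV"
  using sets_eq_imp_space_eq[OF sets_kernel] by simp

lemma fiber_sets [measurable]: "C \<in> sets \<mu> \<Longrightarrow> fiber C w \<in> sets borel"
  using sets_Pair1[of C P borel w] by (simp add: sets_mu fiber_def vimage_def)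

lemma emeasure_fiber_measurable [measurable]:
  assumes "C \<in> sets \<mu>"
  shows "(\<lambda>w. emeasure (\<kappa> w) (fiber C w)) \<in> borel_measurable P"
proof (rule emeasure_measurable_subprob_algebra2)
  have "(SIGMA w:space P. fiber C w) = C" by auto
  then show "(SIGMA w:space P. fiber C w) \<in> sets (P \<Otimes>\<^sub>M borel)"
    using assms by (simp add: sets_mu)
qed (rule measurable_prob_algebraD[OF kernel_measurable])

lemma measure_fiber_measurable [measurable]:
  assumes [measurable]: "C \<in> sets \<mu>"
  shows "(\<lambda>w. measure (\<kappa> w) (fiber C w)) \<in> borel_measurable P"
  unfolding measure_def by measurable

lemma emeasure_mu:
  "C \<in> sets \<mu> \<Longrightarrow> emeasure \<mu> C = (\<integral>\<^sup>+ w. emeasure (\<kappa> w) (fiber C w) \<partial>P)"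
  using disint by (simp add: disintegration_def)

lemma AE_kernel_fiber:
  assumes C [measurable]: "C \<in> sets \<mu>" and AE: "AE z in \<mu>. z \<in> C"
  shows "AE w in P. AE x in \<kappa> w. (w, x) \<in> C"
proof -
  have comp [measurable]: "- C \<in> sets \<mu>"
    using sets.compl_sets[OF C] by (simp add: Compl_eq_Diff_UNIV)
  have "emeasure \<mu> (- C) = 0"
    using AE AE_iff_measurable[OF comp, of "\<lambda>z. z \<in> C"] by auto
  then have "AE w in P. emeasure (\<kappa> w) (fiber (- C) w) = 0"
    by (simp add: emeasure_mu nn_integral_0_iff_AE)
  then show ?thesis
  proof eventually_elim
    case (elim w)
    then show ?case
      by (intro AE_I'[of "fiber (- C) w"]) (auto intro!: null_setsI)
  qed
qed

text \<open>
  Both sides, as functions of \<open>w\<close>, have the same integral over every measurable set \<open>V\<close> of base points: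
  it is the measure of the part of \<open>T -` C\<close> above \<open>V\<close>. Invertibility of \<open>\<theta>\<close> is what makes this
  part the \<open>T\<close>-preimage of the part of \<open>C\<close> above \<open>\<theta> ` V\<close>.
\<close>

lemma kernel_equivariant_step:
  assumes C [measurable]: "C \<in> sets \<mu>" and CE: "C \<subseteq> E"
  shows "AE w in P. emeasure (\<kappa> w) (fiber (T -` C) w) = emeasure (\<kappa> (\<theta> w)) (fiber C (\<theta> w))"
proof -
  note [measurable] = base_measurable base_inv_measurable
  have TC [measurable]: "T -` C \<in> sets \<mu>"
    using measurable_sets[OF T_measurable C] by simp
  let ?g = "\<lambda>w. emeasure (\<kappa> w) (fiber (T -` C) w)"
  let ?h = "\<lambda>w. emeasure (\<kappa> (\<theta> w)) (fiber C (\<theta> w))"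
  have [measurable]: "?h \<in> borel_measurable P"
    using measurable_compose[OF base_measurable emeasure_fiber_measurable[OF C]] .
  have "density P ?g = density P ?h"
  proof (rule measure_eqI)
    fix V assume "V \<in> sets (density P ?g)"
    then have V [measurable]: "V \<in> sets P" by simp
    \<comment> \<open>The inverse image under \<open>inv \<theta>\<close> is the direct image under \<open>\<theta>\<close>, in a form whose measurability
      follows from that of \<open>inv \<theta>\<close>.\<close>
    define V' where "V' = inv \<theta> -` V"
    have V' [measurable]: "V' \<in> sets P"
      unfolding V'_def using measurable_sets[OF base_inv_measurable V] by simp
    have V'_iff: "\<theta> w \<in> V' \<longleftrightarrow> w \<in> V" for w
      using base_bij by (simp add: V'_def bij_is_inj)
    have rect [measurable]: "D \<inter> (W \<times> UNIV) \<in> sets \<mu>" if "D \<in> sets \<mu>" "W \<in> sets P" for D W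
      using that by (auto simp: sets_mu intro!: sets.Int pair_measureI)
    have cut: "emeasure \<mu> (D \<inter> (W \<times> UNIV)) = (\<integral>\<^sup>+ w. emeasure (\<kappa> w) (fiber D w) * indicator W w \<partial>P)"
      if D: "D \<in> sets \<mu>" and W: "W \<in> sets P" for D W
      using rect[OF D W]
      by (subst emeasure_mu) (auto intro!: nn_integral_cong simp: fiber_def indicator_def)
    have "emeasure (density P ?g) V = emeasure \<mu> (T -` C \<inter> (V \<times> UNIV))"
      by (simp add: emeasure_density cut)
    also have "T -` C \<inter> (V \<times> UNIV) = T -` (C \<inter> (V' \<times> UNIV))"
    proof (intro set_eqI)
      fix z
      have "fst (T z) = \<theta> (fst z)" if "T z \<in> C"
        using that CE T_in_E_iff[of z] by (auto simp: T_def skew_product_def split: prod.splits)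
      then show "z \<in> T -` C \<inter> (V \<times> UNIV) \<longleftrightarrow> z \<in> T -` (C \<inter> (V' \<times> UNIV))"
        using V'_iff[of "fst z"] by (auto simp: mem_Times_iff)
    qed
    also have "emeasure \<mu> \<dots> = emeasure (distr \<mu> \<mu> T) (C \<inter> (V' \<times> UNIV))"
      using T_measurable rect[OF C V'] by (subst emeasure_distr) auto
    also have "\<dots> = (\<integral>\<^sup>+ w. emeasure (\<kappa> w) (fiber C w) * indicator V' w \<partial>P)"
      using C V' by (simp only: T_preserving cut)
    also have "\<dots> = (\<integral>\<^sup>+ w. emeasure (\<kappa> w) (fiber C w) * indicator V' w \<partial>distr P P \<theta>)"
      by (simp only: base_preserving)
    also have "\<dots> = (\<integral>\<^sup>+ w. ?h w * indicator V w \<partial>P)"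
      by (subst nn_integral_distr) (auto intro!: nn_integral_cong simp: V'_iff indicator_def)
    also have "\<dots> = emeasure (density P ?h) V"
      by (simp add: emeasure_density)
    finally show "emeasure (density P ?g) V = emeasure (density P ?h) V" .
  qed simp
  then show ?thesis
    by (intro density_unique) auto
qed

lemma AE_base_shift:
  assumes "AE w in P. Q w"
  shows "AE w in P. Q (\<theta> w)"
proof -
  have "AE w in distr P P \<theta>. Q w" using assms unfolding base_preserving .
  then show ?thesis by (rule AE_distrD[OF base_measurable])
qed

lemma kernel_equivariant:
  assumes C: "C \<in> sets \<mu>" and CE: "C \<subseteq> E"
  shows "AE w in P. measure (\<kappa> w) (fiber ((T ^^ k) -` C) w)
    = measure (\<kappa> ((\<theta> ^^ k) w)) (fiber C ((\<theta> ^^ k) w))"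
proof (induction k)
  case (Suc k)
  have meas: "(T ^^ k) -` C \<in> sets \<mu>"
    using measurable_sets[OF mu.iterate_measurable C, of k] by simp
  have "(T ^^ k) -` C \<subseteq> E"
    using CE iterate_in_E_iff by blast
  note kernel_equivariant_step[OF meas this]
  moreover note AE_base_shift[OF Suc]
  ultimately show ?case
  proof eventually_elim
    case (elim w)
    have "(T ^^ Suc k) -` C = T -` ((T ^^ k) -` C)"
      by (auto simp: funpow_swap1)
    then show ?case
      using elim unfolding funpow_Suc_right o_apply by (simp add: measure_def)
  qed
qed simp

end

section \<open>Cells of a partition and positive entropy\<close>

locale partitioned_rds = ergodic_rds P \<theta> E f \<mu> \<kappa>
  for P :: "'w :: polish_space measure"
    and \<theta> :: "'w \<Rightarrow> 'w"
    and E :: "('w \<times> 'x :: polish_space) set"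
    and f :: "'w \<Rightarrow> 'x \<Rightarrow> 'x"
    and \<mu> :: "('w \<times> 'x) measure" and \<kappa> :: "'w \<Rightarrow> 'x measure" +
  fixes R :: "('w \<times> 'x) set set"
  assumes partition: "finite_measurable_partition P E R"
begin

lemma finite_R: "finite R"
  and sets_R: "A \<in> R \<Longrightarrow> A \<in> sets \<mu>"
  and partition_R: "partition_on E R"
  using partition by (auto simp: finite_measurable_partition_def sets_mu)

definition symbol :: "'w \<times> 'x \<Rightarrow> ('w \<times> 'x) set" where
  "symbol z = (THE A. A \<in> R \<and> z \<in> A)"

lemma symbol_eq: "A \<in> R \<Longrightarrow> z \<in> A \<Longrightarrow> symbol z = A"
  using partition_onD2[OF partition_R] unfolding symbol_def
  by (intro the_equality) (auto dest: disjointD)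

lemma symbol_in: "z \<in> E \<Longrightarrow> symbol z \<in> R" and mem_symbol: "z \<in> E \<Longrightarrow> z \<in> symbol z"
  using partition_onD1[OF partition_R] symbol_eq by (metis UnionE)+

definition itineraries :: "nat \<Rightarrow> (nat \<Rightarrow> ('w \<times> 'x) set) set" where
  "itineraries n = {..<n} \<rightarrow>\<^sub>E R"

lemma finite_itineraries: "finite (itineraries n)"
  and card_itineraries: "card (itineraries n) = card R ^ n"
  by (auto simp: itineraries_def card_PiE finite_R intro!: finite_PiE)

text \<open>
  Restricted to \<open>{..<n}\<close>, so that itineraries of length \<open>n\<close> form the finite set \<open>itineraries n\<close> and
  can be compared by equality.
\<close>

definition itinerary :: "nat \<Rightarrow> 'w \<times> 'x \<Rightarrow> nat \<Rightarrow> ('w \<times> 'x) set" where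
  "itinerary n z = (\<lambda>i\<in>{..<n}. symbol ((T ^^ i) z))"

lemma itinerary_in: "z \<in> E \<Longrightarrow> itinerary n z \<in> itineraries n"
  by (auto simp: itinerary_def itineraries_def symbol_in)

definition cylinder :: "nat \<Rightarrow> (nat \<Rightarrow> ('w \<times> 'x) set) \<Rightarrow> ('w \<times> 'x) set" where
  "cylinder n a = {z \<in> E. \<forall>i<n. (T ^^ i) z \<in> a i}"

lemma cylinder_sets [measurable]:
  assumes a: "a \<in> itineraries n"
  shows "cylinder n a \<in> sets \<mu>"
proof -
  have "(T ^^ i) -` a i \<inter> space \<mu> \<in> sets \<mu>" if "i < n" for i
  proof (rule measurable_sets[OF mu.iterate_measurable])
    show "a i \<in> sets \<mu>"
      using a that by (intro sets_R) (auto simp: itineraries_def)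
  qed
  then have "E - (\<Union>i\<in>{..<n}. space \<mu> - ((T ^^ i) -` a i \<inter> space \<mu>)) \<in> sets \<mu>"
    by (intro sets.Diff[OF E_sets] sets.finite_UN sets.Diff[OF sets.top]) auto
  also have "E - (\<Union>i\<in>{..<n}. space \<mu> - ((T ^^ i) -` a i \<inter> space \<mu>)) = cylinder n a"
    by (auto simp: cylinder_def)
  finally show ?thesis .
qed

lemma mem_cylinder_iff:
  assumes "a \<in> itineraries n"
  shows "z \<in> cylinder n a \<longleftrightarrow> z \<in> E \<and> itinerary n z = a"
proof
  assume z: "z \<in> cylinder n a"
  have "itinerary n z i = a i" for i
  proof (cases "i < n")
    case True
    then have "a i \<in> R" "(T ^^ i) z \<in> a i"
      using z assms by (auto simp: cylinder_def itineraries_def)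
    then show ?thesis
      using True by (simp add: itinerary_def symbol_eq)
  next
    case False
    then show ?thesis
      using PiE_arb[OF assms[unfolded itineraries_def], of i] by (simp add: itinerary_def)
  qed
  then have "itinerary n z = a"
    by (rule ext)
  then show "z \<in> E \<and> itinerary n z = a"
    using z by (simp add: cylinder_def)
next
  assume "z \<in> E \<and> itinerary n z = a"
  then have z: "z \<in> E" and a: "a = itinerary n z" by auto
  show "z \<in> cylinder n a"
    using z mem_symbol[of "(T ^^ i) z" for i] unfolding a by (simp add: cylinder_def itinerary_def)
qed

definition cell_mass :: "nat \<Rightarrow> 'w \<times> 'x \<Rightarrow> real" where
  "cell_mass n z = measure (\<kappa> (fst z)) (fiber (cylinder n (itinerary n z)) (fst z))"

lemma cell_mass_eq:
  "a \<in> itineraries n \<Longrightarrow> z \<in> cylinder n a \<Longrightarrow> cell_mass n z = measure (\<kappa> (fst z)) (fiber (cylinder n a) (fst z))"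
  by (simp add: cell_mass_def mem_cylinder_iff)

text \<open>
  Positive entropy puts almost every point, for some \<open>c > 0\<close>, into these sets for
  infinitely many \<open>n\<close>: a weak form of the Shannon-McMillan-Breiman theorem.
\<close>

definition small_cells :: "real \<Rightarrow> nat \<Rightarrow> ('w \<times> 'x) set" where
  "small_cells c n = {z \<in> E. cell_mass n z < exp (- c * n)}"

lemma small_cells_sets [measurable]: "small_cells c n \<in> sets \<mu>"
proof -
  have [measurable]: "fst \<in> \<mu> \<rightarrow>\<^sub>M P" by measurable
  have "small_cells c n = (\<Union>a\<in>itineraries n. cylinder n a \<inter>
      {z \<in> space \<mu>. measure (\<kappa> (fst z)) (fiber (cylinder n a) (fst z)) < exp (- c * n)})"
    using itinerary_in by (auto simp: small_cells_def mem_cylinder_iff cell_mass_def)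
  also have "\<dots> \<in> sets \<mu>"
  proof (intro sets.finite_UN finite_itineraries sets.Int cylinder_sets)
    fix a assume "a \<in> itineraries n"
    note [measurable] = measurable_compose[OF \<open>fst \<in> \<mu> \<rightarrow>\<^sub>M P\<close> measure_fiber_measurable[OF cylinder_sets[OF this]]]
    show "{z \<in> space \<mu>. measure (\<kappa> (fst z)) (fiber (cylinder n a) (fst z)) < exp (- c * n)} \<in> sets \<mu>"
      by measurable
  qed
  finally show ?thesis .
qed

lemma iterated_join_subset: "iterated_join \<theta> E f R n \<subseteq> cylinder n ` itineraries n"
proof
  fix A assume "A \<in> iterated_join \<theta> E f R n"
  then obtain c where A: "A = E \<inter> (\<Inter>i<n. (skew_product \<theta> f ^^ i) -` c i)" and c: "\<forall>i<n. c i \<in> R"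
    by (auto simp: iterated_join_def)
  have "A = cylinder n (restrict c {..<n})"
    unfolding A cylinder_def by (auto simp: iterate_eq_skew_product)
  moreover have "restrict c {..<n} \<in> itineraries n"
    using c by (auto simp: itineraries_def)
  ultimately show "A \<in> cylinder n ` itineraries n" by blast
qed

lemma one_le_card_R: "1 \<le> card R"
proof -
  have "R \<noteq> {}"
  proof
    assume "R = {}"
    then have "E = {}" using partition_onD1[OF partition_R] by simp
    then show False using AE_mu_E mu.AE_False by simp
  qed
  then show ?thesis
    using finite_R by (simp add: Suc_le_eq card_gt_0_iff)
qed

lemma cond_entropy_le:
  assumes c: "0 \<le> c"
  shows "cond_entropy P \<kappa> (iterated_join \<theta> E f R n)
    \<le> ennreal (c * n + ln (card R) * n * measure \<mu> (small_cells c n) + 1)"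
proof -
  let ?J = "iterated_join \<theta> E f R n" and ?B = "small_cells c n"
  note q = one_le_card_R
  have fiberwise: "partition_entropy (\<kappa> w) (fiber_partition ?J w)
      \<le> ennreal (c * n + 1) + ennreal (ln (card R) * n) * emeasure (\<kappa> w) (fiber ?B w)" for w
  proof -
    interpret kw: prob_space "\<kappa> w" by (rule kernel_prob_space)
    have sub: "fiber_partition ?J w \<subseteq> (\<lambda>a. fiber (cylinder n a) w) ` itineraries n"
      using iterated_join_subset by (auto simp: fiber_partition_def)
    have "partition_entropy (\<kappa> w) (fiber_partition ?J w)
        \<le> ennreal (c * n + ln (card R ^ n) * measure (\<kappa> w) (fiber ?B w) + 1)"
    proof (rule partition_entropy_le[OF kernel_prob_space])
      show "finite (fiber_partition ?J w)"
        by (rule finite_subset[OF sub finite_imageI[OF finite_itineraries]])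
      show "fiber_partition ?J w \<subseteq> sets (\<kappa> w)"
        by (rule order_trans[OF sub]) (auto intro: fiber_sets cylinder_sets)
      \<comment> \<open>Different atoms may have the same fibre only if it is empty, so the fibres of different atoms
        are disjoint, and collapsing equal fibres to one set is harmless.\<close>
      show "disjoint (fiber_partition ?J w)"
      proof (rule disjointI)
        fix A B assume A: "A \<in> fiber_partition ?J w" and B: "B \<in> fiber_partition ?J w" and "A \<noteq> B"
        obtain a where a: "a \<in> itineraries n" "A = fiber (cylinder n a) w"
          using subsetD[OF sub A] by (rule imageE)
        obtain b where b: "b \<in> itineraries n" "B = fiber (cylinder n b) w"
          using subsetD[OF sub B] by (rule imageE)
        have "a \<noteq> b" using \<open>A \<noteq> B\<close> a b by auto
        then show "A \<inter> B = {}"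
          using a b by (auto simp: mem_cylinder_iff)
      qed
      show "card (fiber_partition ?J w) \<le> card R ^ n"
        unfolding card_itineraries[symmetric]
        by (rule order_trans[OF card_mono[OF finite_imageI[OF finite_itineraries] sub]
              card_image_le[OF finite_itineraries]])
      show "1 \<le> card R ^ n" using q by simp
      show "fiber ?B w \<in> sets (\<kappa> w)" by simp
      show "A \<subseteq> fiber ?B w" if "A \<in> fiber_partition ?J w" "measure (\<kappa> w) A < exp (- (c * real n))" for A
      proof -
        obtain a where "a \<in> itineraries n" "A = fiber (cylinder n a) w"
          using subsetD[OF sub \<open>A \<in> fiber_partition ?J w\<close>] by (rule imageE)
        then show ?thesis
          using that(2) by (auto simp: small_cells_def cell_mass_eq mem_cylinder_iff)
      qed
    qed (use c in auto)
    also have "\<dots> = ennreal (c * n + 1) + ennreal (ln (card R) * n * measure (\<kappa> w) (fiber ?B w))"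
      using c q by (subst ennreal_plus[symmetric]) (auto simp: ln_realpow algebra_simps)
    also have "\<dots> = ennreal (c * n + 1) + ennreal (ln (card R) * n) * emeasure (\<kappa> w) (fiber ?B w)"
      using q by (simp add: kw.emeasure_eq_measure ennreal_mult)
    finally show ?thesis .
  qed
  have "cond_entropy P \<kappa> ?J
      \<le> (\<integral>\<^sup>+ w. ennreal (c * n + 1) + ennreal (ln (card R) * n) * emeasure (\<kappa> w) (fiber ?B w) \<partial>P)"
    unfolding cond_entropy_def by (intro nn_integral_mono fiberwise)
  also have "\<dots> = ennreal (c * n + 1) + ennreal (ln (card R) * n) * emeasure \<mu> ?B"
    by (simp add: nn_integral_add nn_integral_cmult emeasure_mu emeasure_space_1 del: space_base)
  also have "\<dots> = ennreal (c * n + ln (card R) * n * measure \<mu> ?B + 1)"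
    using c q by (simp add: mu.emeasure_eq_measure flip: ennreal_mult ennreal_plus)
  finally show ?thesis .
qed

text \<open>
  In the estimate for the entropy of the \<open>n\<close>-th join the factor \<open>ln (card R) * n\<close> is harmless after
  division by \<open>n\<close>, because it is multiplied by the measure of \<open>small_cells c n\<close>, which tends to \<open>0\<close>
  by dominated convergence; the remaining rate \<open>c\<close> is arbitrary.
\<close>

lemma relative_entropy_zero:
  assumes "\<And>c. 0 < c \<Longrightarrow> AE z in \<mu>. eventually (\<lambda>n. z \<notin> small_cells c n) sequentially"
  shows "partition_relative_entropy P \<theta> E f \<kappa> R = 0"
proof -
  let ?H = "\<lambda>n. cond_entropy P \<kappa> (iterated_join \<theta> E f R n)"
  have vanish: "(\<lambda>n. measure \<mu> (small_cells c n)) \<longlonglongrightarrow> 0" if "0 < c" for c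
  proof -
    have "(\<lambda>n. (\<integral>z. indicator (small_cells c n) z \<partial>\<mu>)) \<longlonglongrightarrow> (\<integral>z. 0 \<partial>\<mu> :: real)"
    proof (rule integral_dominated_convergence[where w = "\<lambda>_. 1"])
      show "AE z in \<mu>. (\<lambda>n. indicator (small_cells c n) z :: real) \<longlonglongrightarrow> 0"
        using assms[OF \<open>0 < c\<close>]
      proof eventually_elim
        case (elim z)
        then show ?case
          by (intro tendsto_eventually) (auto elim: eventually_mono simp: indicator_def)
      qed
    qed (auto simp: indicator_def)
    then show ?thesis by simp
  qed
  have "(\<lambda>n. ?H n / of_nat n) \<longlonglongrightarrow> 0"
  proof (rule order_tendstoI)
    fix a :: ennreal assume "0 < a"
    then obtain b where b: "0 < b" "b < a" using dense by blast
    then obtain e where e: "b = ennreal e" "0 < e"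
      by (cases b) (auto simp: top_unique)
    let ?r = "\<lambda>n. e / 2 + ln (card R) * measure \<mu> (small_cells (e / 2) n) + 1 / real n"
    have lim: "?r \<longlonglongrightarrow> e / 2 + ln (card R) * 0 + 0"
      using e by (intro tendsto_intros vanish lim_1_over_n) auto
    have "eventually (\<lambda>n. ?r n < e) sequentially"
      by (rule order_tendstoD(2)[OF lim]) (use e in simp)
    then show "eventually (\<lambda>n. ?H n / of_nat n < a) sequentially"
      using eventually_gt_at_top[of 0]
    proof eventually_elim
      case (elim n)
      have "?H n / of_nat n \<le> ennreal (e / 2 * n + ln (card R) * n * measure \<mu> (small_cells (e / 2) n) + 1) / of_nat n"
        using e by (intro divide_right_mono_ennreal cond_entropy_le) auto
      also have "\<dots> = ennreal ((e / 2 * n + ln (card R) * n * measure \<mu> (small_cells (e / 2) n) + 1) / n)"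
        using elim e one_le_card_R
        by (subst ennreal_of_nat_eq_real_of_nat, intro divide_ennreal) (auto intro!: add_nonneg_nonneg)
      also have "\<dots> = ennreal (?r n)"
        using elim by (simp add: field_simps)
      also have "\<dots> \<le> ennreal e"
        using elim by (intro ennreal_leI) simp
      finally show ?case using b e by simp
    qed
  qed simp
  then show ?thesis
    unfolding partition_relative_entropy_def by (rule limI)
qed

text \<open>
  By \<open>relative_entropy_zero\<close> the points with infinitely many small cells have positive measure for
  some \<open>c\<close>, hence almost every orbit meets them. The property is pulled back along the orbit by equivariance of the fibre measures: the
  \<open>(n + k)\<close>-cell of \<open>z\<close> lies in the \<open>T ^^ k\<close>-preimage of the \<open>n\<close>-cell of \<open>(T ^^ k) z\<close>, so its mass
  is not larger. Halving \<open>c\<close> pays for the shift by \<open>k\<close>.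
\<close>

lemma AE_small_cells_infinitely_often:
  assumes pos: "partition_relative_entropy P \<theta> E f \<kappa> R > 0"
  obtains c where "0 < c" "AE z in \<mu>. \<exists>\<^sub>\<infinity>n. z \<in> small_cells c n"
proof -
  obtain c where c: "0 < c" and not_AE: "\<not> (AE z in \<mu>. eventually (\<lambda>n. z \<notin> small_cells c n) sequentially)"
    using relative_entropy_zero pos by fastforce
  define A where "A = {z \<in> space \<mu>. \<exists>\<^sub>\<infinity>n. z \<in> small_cells c n}"
  have A [measurable]: "A \<in> sets \<mu>"
    unfolding A_def INFM_nat_le by measurable
  have "mu.prob A > 0"
  proof (rule ccontr)
    assume "\<not> mu.prob A > 0"
    then have "mu.prob A = 0" using measure_nonneg[of \<mu> A] by linarith
    then have "AE z in \<mu>. z \<notin> A"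
      using mu.prob_eq_0[OF A] by simp
    then have "AE z in \<mu>. eventually (\<lambda>n. z \<notin> small_cells c n) sequentially"
      by eventually_elim (simp add: A_def frequently_def cofinite_eq_sequentially)
    with not_AE show False ..
  qed
  then have visit: "AE z in \<mu>. \<exists>k. (T ^^ k) z \<in> A"
    by (rule mu.AE_visits_positive_prob_set[OF A])
  have "AE w in P. \<forall>k n. \<forall>a\<in>itineraries n. measure (\<kappa> w) (fiber ((T ^^ k) -` cylinder n a) w)
      = measure (\<kappa> ((\<theta> ^^ k) w)) (fiber (cylinder n a) ((\<theta> ^^ k) w))"
    using finite_itineraries
    by (intro AE_all_countable[THEN iffD2] allI AE_finite_allI kernel_equivariant cylinder_sets)
       (auto simp: cylinder_def)
  then have equiv: "AE z in \<mu>. \<forall>k n. \<forall>a\<in>itineraries n.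
      measure (\<kappa> (fst z)) (fiber ((T ^^ k) -` cylinder n a) (fst z))
      = measure (\<kappa> ((\<theta> ^^ k) (fst z))) (fiber (cylinder n a) ((\<theta> ^^ k) (fst z)))"
    by (rule AE_fst)
  have "AE z in \<mu>. \<exists>\<^sub>\<infinity>n. z \<in> small_cells (c / 2) n"
    using visit equiv AE_mu_E
  proof eventually_elim
    case (elim z)
    then obtain k where k: "(T ^^ k) z \<in> A" by blast
    have Tz: "(T ^^ k) z \<in> E" using elim by simp
    have step: "z \<in> small_cells (c / 2) (n + k)" if n: "k \<le> n" and "(T ^^ k) z \<in> small_cells c n" for n
    proof -
      let ?a = "itinerary n ((T ^^ k) z)"
      have a: "?a \<in> itineraries n" using Tz by (rule itinerary_in)
      have meas: "fiber ((T ^^ k) -` cylinder n ?a) (fst z) \<in> sets borel"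
        using measurable_sets[OF mu.iterate_measurable cylinder_sets[OF a], of k]
        by (intro fiber_sets) simp
      interpret kw: prob_space "\<kappa> (fst z)" by (rule kernel_prob_space)
      have "cylinder (n + k) (itinerary (n + k) z) \<subseteq> (T ^^ k) -` cylinder n ?a"
      proof
        fix y assume y: "y \<in> cylinder (n + k) (itinerary (n + k) z)"
        have "(T ^^ i) ((T ^^ k) y) \<in> ?a i" if "i < n" for i
        proof -
          have "(T ^^ (i + k)) y \<in> itinerary (n + k) z (i + k)"
            using y that by (simp add: cylinder_def)
          then show ?thesis
            using that by (simp add: itinerary_def funpow_add)
        qed
        then show "y \<in> (T ^^ k) -` cylinder n ?a"
          using y by (auto simp: cylinder_def)
      qed
      then have "cell_mass (n + k) z \<le> measure (\<kappa> (fst z)) (fiber ((T ^^ k) -` cylinder n ?a) (fst z))"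
        unfolding cell_mass_def by (intro kw.finite_measure_mono) (use meas in \<open>auto simp: fiber_def\<close>)
      also have "\<dots> = cell_mass n ((T ^^ k) z)"
        using elim a by (simp add: cell_mass_def fst_iterate)
      also have "\<dots> < exp (- c * n)"
        using that by (simp add: small_cells_def)
      also have "\<dots> \<le> exp (- (c / 2) * (n + k))"
        using c n by (simp add: field_simps)
      finally show ?thesis using elim by (simp add: small_cells_def)
    qed
    show ?case unfolding INFM_nat_le
    proof
      fix m
      obtain n where "max m k \<le> n" "(T ^^ k) z \<in> small_cells c n"
        using k unfolding A_def INFM_nat_le by blast
      then show "\<exists>n\<ge>m. z \<in> small_cells (c / 2) n"
        using step[of n] by (intro exI[of _ "n + k"]) auto
    qed
  qed
  then show ?thesis using c that[of "c / 2"] by simp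
qed

end

context ergodic_rds
begin

section \<open>Tail dynamical balls and stable classes\<close>

text \<open>
  The condition starts at time \<open>m\<close>, so that stable classes, whose points are close only eventually,
  are covered by countably many of these sets.
\<close>

definition tail_ball :: "real \<Rightarrow> nat \<Rightarrow> 'w \<Rightarrow> 'x \<Rightarrow> 'x set" where
  "tail_ball \<delta> m w x =
    {y \<in> fiber E w. \<forall>k\<ge>m. dist (cocycle \<theta> f k w x) (cocycle \<theta> f k w y) \<le> \<delta>}"

lemma Gamma_plus_eq_tail_ball: "Gamma_plus \<theta> E f (\<lambda>_. \<delta>) x w = tail_ball \<delta> 0 w x"
  by (simp add: Gamma_plus_def tail_ball_def)

lemma Pair_measurable [measurable]: "Pair w \<in> borel \<rightarrow>\<^sub>M \<mu>"
  unfolding measurable_cong_sets[OF refl sets_mu] by measurable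

lemma snd_iterate_measurable [measurable]: "(\<lambda>y. snd ((T ^^ k) (w, y))) \<in> borel \<rightarrow>\<^sub>M borel"
proof -
  have "snd \<in> \<mu> \<rightarrow>\<^sub>M borel" by measurable
  then show ?thesis
    using measurable_compose[OF measurable_compose[OF Pair_measurable mu.iterate_measurable]] by blast
qed

lemma tail_ball_sets [measurable]: "tail_ball \<delta> m w x \<in> sets borel"
proof -
  have "fiber E w \<inter> {y \<in> space borel. \<forall>k\<ge>m. dist (cocycle \<theta> f k w x) (snd ((T ^^ k) (w, y))) \<le> \<delta>} \<in> sets borel"
    by measurable
  also have "fiber E w \<inter> {y \<in> space borel. \<forall>k\<ge>m. dist (cocycle \<theta> f k w x) (snd ((T ^^ k) (w, y))) \<le> \<delta>}
      = tail_ball \<delta> m w x"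
    by (auto simp: tail_ball_def iterate_eq)
  finally show ?thesis .
qed

text \<open>
  The maps \<open>f w\<close> are controlled only on the fibres, therefore the iterates are replaced by those of the
  total map \<open>T\<close>, and convergence is written with countably many conditions.
\<close>

lemma stable_class_sets [measurable]: "stable_class \<theta> E f w p \<in> sets borel"
proof -
  have "fiber E w \<inter> {y \<in> space borel. \<forall>j. \<exists>N. \<forall>n\<ge>N. dist (snd ((T ^^ n) (w, y))) (cocycle \<theta> f n w p) < 1 / real (Suc j)}
      \<in> sets borel"
    by measurable
  also have "fiber E w \<inter> {y \<in> space borel. \<forall>j. \<exists>N. \<forall>n\<ge>N. dist (snd ((T ^^ n) (w, y))) (cocycle \<theta> f n w p) < 1 / real (Suc j)}
      = stable_class \<theta> E f w p"
  proof (intro set_eqI)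
    fix y
    have "(\<forall>j. \<exists>N. \<forall>n\<ge>N. a n < 1 / real (Suc j)) \<longleftrightarrow> a \<longlonglongrightarrow> 0"
      if "\<And>n. 0 \<le> a n" for a :: "nat \<Rightarrow> real"
    proof
      assume lim: "\<forall>j. \<exists>N. \<forall>n\<ge>N. a n < 1 / real (Suc j)"
      show "a \<longlonglongrightarrow> 0"
      proof (rule LIMSEQ_I)
        fix r :: real assume "0 < r"
        then obtain j where "1 / real (Suc j) < r"
          using nat_approx_posE by blast
        moreover obtain N where "\<forall>n\<ge>N. a n < 1 / real (Suc j)" using lim by blast
        ultimately show "\<exists>N. \<forall>n\<ge>N. norm (a n - 0) < r"
          using that by (intro exI[of _ N]) (auto intro: less_trans)
      qed
    next
      assume "a \<longlonglongrightarrow> 0"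
      then show "\<forall>j. \<exists>N. \<forall>n\<ge>N. a n < 1 / real (Suc j)"
        using order_tendstoD(2)[of a 0 sequentially] unfolding eventually_sequentially by simp
    qed
    from this[of "\<lambda>n. dist (cocycle \<theta> f n w y) (cocycle \<theta> f n w p)"]
    show "y \<in> fiber E w \<inter> {y \<in> space borel. \<forall>j. \<exists>N. \<forall>n\<ge>N. dist (snd ((T ^^ n) (w, y))) (cocycle \<theta> f n w p) < 1 / real (Suc j)}
        \<longleftrightarrow> y \<in> stable_class \<theta> E f w p"
      by (cases "(w, y) \<in> E") (simp_all add: stable_class_def iterate_eq)
  qed
  finally show ?thesis .
qed

lemma stable_class_subset_tail_balls:
  assumes "0 < \<delta>"
  shows "stable_class \<theta> E f w p \<subseteq> (\<Union>m. tail_ball \<delta> m w p)"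
proof
  fix y assume y: "y \<in> stable_class \<theta> E f w p"
  then have "(\<lambda>n. dist (cocycle \<theta> f n w y) (cocycle \<theta> f n w p)) \<longlonglongrightarrow> 0"
    by (simp add: stable_class_def)
  from order_tendstoD(2)[OF this assms]
  obtain m where "\<forall>n\<ge>m. dist (cocycle \<theta> f n w y) (cocycle \<theta> f n w p) < \<delta>"
    by (auto simp: eventually_sequentially)
  then show "y \<in> (\<Union>m. tail_ball \<delta> m w p)"
    using y by (auto simp: tail_ball_def stable_class_def dist_commute intro!: exI[of _ m] less_imp_le)
qed

lemma tail_ball_subset_tail_ball:
  assumes "y \<in> tail_ball (\<delta> / 2) m w x"
  shows "tail_ball (\<delta> / 2) m w x \<subseteq> tail_ball \<delta> m w y"
proof
  fix z assume z: "z \<in> tail_ball (\<delta> / 2) m w x"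
  have "dist (cocycle \<theta> f k w y) (cocycle \<theta> f k w z) \<le> \<delta>" if "k \<ge> m" for k
  proof -
    have "dist (cocycle \<theta> f k w x) (cocycle \<theta> f k w y) \<le> \<delta> / 2" "dist (cocycle \<theta> f k w x) (cocycle \<theta> f k w z) \<le> \<delta> / 2"
      using assms z that by (auto simp: tail_ball_def)
    then show ?thesis
      using dist_triangle3[of "cocycle \<theta> f k w y" "cocycle \<theta> f k w z" "cocycle \<theta> f k w x"] by linarith
  qed
  then show "z \<in> tail_ball \<delta> m w y"
    using z by (simp add: tail_ball_def)
qed

end

section \<open>Tail dynamical balls are null\<close>

lemma separated_compact_family:
  fixes K :: "'i \<Rightarrow> 'a :: metric_space set"
  assumes I: "finite I" and K: "\<And>i. i \<in> I \<Longrightarrow> compact (K i)"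
    and disj: "\<And>i j. i \<in> I \<Longrightarrow> j \<in> I \<Longrightarrow> i \<noteq> j \<Longrightarrow> K i \<inter> K j = {}"
  obtains \<delta> where "0 < \<delta>"
    "\<And>i j x y. i \<in> I \<Longrightarrow> j \<in> I \<Longrightarrow> i \<noteq> j \<Longrightarrow> x \<in> K i \<Longrightarrow> y \<in> K j \<Longrightarrow> \<delta> < dist x y"
proof -
  let ?J = "{p \<in> I \<times> I. fst p \<noteq> snd p}"
  have "\<exists>d>0. \<forall>x\<in>K (fst p). \<forall>y\<in>K (snd p). d \<le> dist x y" if "p \<in> ?J" for p
  proof (cases "K (fst p) \<times> K (snd p) = {}")
    case True
    then show ?thesis by (intro exI[of _ 1]) auto
  next
    case False
    have p: "fst p \<in> I" "snd p \<in> I" "fst p \<noteq> snd p" using that by auto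
    have "continuous_on (K (fst p) \<times> K (snd p)) (\<lambda>z. dist (fst z) (snd z))"
      by (intro continuous_intros)
    from continuous_attains_inf[OF compact_Times[OF K[OF p(1)] K[OF p(2)]] False this]
    obtain z where z: "z \<in> K (fst p) \<times> K (snd p)"
      "\<forall>z'\<in>K (fst p) \<times> K (snd p). dist (fst z) (snd z) \<le> dist (fst z') (snd z')" by blast
    have "fst z \<noteq> snd z" using z(1) disj[OF p] by auto
    then show ?thesis
      using z(2) by (intro exI[of _ "dist (fst z) (snd z)"]) auto
  qed
  then have "\<forall>p\<in>?J. \<exists>d>0. \<forall>x\<in>K (fst p). \<forall>y\<in>K (snd p). d \<le> dist x y"
    by blast
  from bchoice[OF this] obtain d
    where "\<forall>p\<in>?J. 0 < d p \<and> (\<forall>x\<in>K (fst p). \<forall>y\<in>K (snd p). d p \<le> dist x y)"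
    by blast
  then have d: "\<And>p. p \<in> ?J \<Longrightarrow> 0 < d p"
    "\<And>p x y. p \<in> ?J \<Longrightarrow> x \<in> K (fst p) \<Longrightarrow> y \<in> K (snd p) \<Longrightarrow> d p \<le> dist x y"
    by blast+
  have fin: "finite (insert 1 (d ` ?J))" using I by simp
  \<comment> \<open>Half of the minimal distance, to have a strict inequality; the inserted \<open>1\<close> covers the case
    that there is only one set.\<close>
  define \<delta> where "\<delta> = Min (insert 1 (d ` ?J)) / 2"
  have "0 < Min (insert 1 (d ` ?J))"
    using fin d(1) by (subst Min_gr_iff) auto
  then have pos: "0 < \<delta>" by (simp add: \<delta>_def)
  have "\<delta> < dist x y" if "i \<in> I" "j \<in> I" "i \<noteq> j" "x \<in> K i" "y \<in> K j" for i j x y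
  proof -
    have ij: "(i, j) \<in> ?J" using that by simp
    then have "2 * \<delta> \<le> d (i, j)"
      unfolding \<delta>_def using fin by (auto intro: Min_le)
    also have "\<dots> \<le> dist x y" using d(2)[OF ij] that by simp
    finally show ?thesis using pos by linarith
  qed
  with pos that show ?thesis by blast
qed

context partitioned_rds
begin

text \<open>
  This is where the constant \<open>\<delta>\<close> comes from. The product of the base and the phase space is Polish,
  so every element of the partition contains a compact subset of almost full measure. Finitely many
  disjoint compact sets have a positive distance from each other, uniformly over all fibres.
\<close>

lemma separated_cores:
  assumes \<epsilon>: "0 < \<epsilon>"
  obtains \<delta> B where "0 < \<delta>" "B \<in> sets \<mu>" "mu.prob B < \<epsilon>"
    "\<And>y z. y \<in> E \<Longrightarrow> z \<in> E \<Longrightarrow> y \<notin> B \<Longrightarrow> z \<notin> B \<Longrightarrow> dist y z \<le> \<delta> \<Longrightarrow> symbol y = symbol z"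
proof -
  \<comment> \<open>The factor 2 turns the non-strict bound for the sum over \<open>R\<close> into a strict one.\<close>
  let ?e = "\<epsilon> / (2 * card R)"
  have e: "0 < ?e" using \<epsilon> one_le_card_R by simp
  have "\<exists>K. compact K \<and> K \<subseteq> A \<and> mu.prob (A - K) \<le> ?e" if A: "A \<in> R" for A
  proof -
    have "A \<in> sets borel" using sets_R[OF A] sets_mu_borel by simp
    then have "emeasure \<mu> A = (SUP K \<in> {K. K \<subseteq> A \<and> compact K}. emeasure \<mu> K)"
      by (intro inner_regular sets_mu_borel) auto
    then have "\<exists>K\<in>{K. K \<subseteq> A \<and> compact K}. emeasure \<mu> A < emeasure \<mu> K + ennreal ?e"
      by (rule SUP_approx_ennreal[OF e, rotated]) (use compact_empty in auto)
    then obtain K where K: "K \<subseteq> A" "compact K" "emeasure \<mu> A < emeasure \<mu> K + ennreal ?e"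
      by blast
    have "K \<in> sets \<mu>" using K(2) by (simp add: sets_mu_borel borel_compact)
    then have "mu.prob (A - K) = mu.prob A - mu.prob K"
      using sets_R[OF A] K(1) by (intro mu.finite_measure_Diff)
    moreover have "ennreal (mu.prob A) < ennreal (mu.prob K + ?e)"
      using K(3) e by (simp add: mu.emeasure_eq_measure)
    then have "mu.prob A < mu.prob K + ?e"
      using e by (subst (asm) ennreal_less_iff) auto
    ultimately show ?thesis using K by (intro exI[of _ K]) auto
  qed
  then obtain K where K: "\<And>A. A \<in> R \<Longrightarrow> compact (K A)" "\<And>A. A \<in> R \<Longrightarrow> K A \<subseteq> A"
    "\<And>A. A \<in> R \<Longrightarrow> mu.prob (A - K A) \<le> ?e"
    by metis
  have K_sets: "K A \<in> sets \<mu>" if "A \<in> R" for A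
    using K(1)[OF that] by (simp add: sets_mu_borel borel_compact)
  have disj: "K A \<inter> K B = {}" if "A \<in> R" "B \<in> R" "A \<noteq> B" for A B
    using K(2)[OF that(1)] K(2)[OF that(2)] partition_onD2[OF partition_R] that by (blast dest: disjointD)
  obtain \<delta> where \<delta>: "0 < \<delta>"
    "\<And>A B x y. A \<in> R \<Longrightarrow> B \<in> R \<Longrightarrow> A \<noteq> B \<Longrightarrow> x \<in> K A \<Longrightarrow> y \<in> K B \<Longrightarrow> \<delta> < dist x y"
    using separated_compact_family[OF finite_R, of K] K(1) disj by metis
  define B where "B = (\<Union>A\<in>R. A - K A)"
  have "B \<in> sets \<mu>"
    unfolding B_def using finite_R sets_R K_sets by (intro sets.finite_UN sets.Diff)
  moreover have "mu.prob B < \<epsilon>"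
  proof -
    have "mu.prob B \<le> (\<Sum>A\<in>R. mu.prob (A - K A))"
      unfolding B_def using finite_R sets_R K_sets
      by (intro mu.finite_measure_subadditive_finite) auto
    also have "\<dots> \<le> card R * ?e"
      using K(3) by (rule sum_bounded_above)
    also have "\<dots> < \<epsilon>" using \<epsilon> one_le_card_R by simp
    finally show ?thesis .
  qed
  moreover have "symbol y = symbol z"
    if yz: "y \<in> E" "z \<in> E" "y \<notin> B" "z \<notin> B" and close: "dist y z \<le> \<delta>" for y z
  proof (rule ccontr)
    assume "symbol y \<noteq> symbol z"
    moreover have "y \<in> K (symbol y)" "z \<in> K (symbol z)"
      using yz mem_symbol symbol_in by (auto simp: B_def)
    ultimately have "\<delta> < dist y z"
      using yz symbol_in by (intro \<delta>(2)) auto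
    with close show False by simp
  qed
  ultimately show ?thesis using \<delta>(1) that by blast
qed

text \<open>
  Two points of the same fibre have different symbols only before time \<open>m\<close>, or when one of the
  two orbits is in the exceptional set \<open>B\<close>.
\<close>

lemma tail_ball_itineraries:
  assumes sep: "\<And>y z. y \<in> E \<Longrightarrow> z \<in> E \<Longrightarrow> y \<notin> B \<Longrightarrow> z \<notin> B \<Longrightarrow> dist y z \<le> \<delta> \<Longrightarrow> symbol y = symbol z"
    and x: "(w, x) \<in> E" and y: "y \<in> tail_ball \<delta> m w x"
  shows "card {i. i < n \<and> itinerary n (w, y) i \<noteq> itinerary n (w, x) i}
    \<le> m + mu.visits B n (w, x) + mu.visits B n (w, y)"
proof -
  let ?V = "\<lambda>z. {i. i < n \<and> (T ^^ i) z \<in> B}"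
  have yE: "(w, y) \<in> E" using y by (simp add: tail_ball_def)
  have "{i. i < n \<and> itinerary n (w, y) i \<noteq> itinerary n (w, x) i} \<subseteq> {..<m} \<union> ?V (w, x) \<union> ?V (w, y)"
  proof (rule subsetI, rule ccontr)
    fix i assume i: "i \<in> {i. i < n \<and> itinerary n (w, y) i \<noteq> itinerary n (w, x) i}"
      and not_in: "i \<notin> {..<m} \<union> ?V (w, x) \<union> ?V (w, y)"
    have "dist ((T ^^ i) (w, y)) ((T ^^ i) (w, x)) \<le> \<delta>"
      using not_in y x yE by (auto simp: iterate_eq dist_Pair_Pair tail_ball_def dist_commute)
    moreover have "(T ^^ i) (w, x) \<notin> B" "(T ^^ i) (w, y) \<notin> B" using i not_in by auto
    ultimately have "symbol ((T ^^ i) (w, y)) = symbol ((T ^^ i) (w, x))"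
      using x yE by (intro sep) auto
    with i show False by (auto simp: itinerary_def)
  qed
  then have "card {i. i < n \<and> itinerary n (w, y) i \<noteq> itinerary n (w, x) i}
      \<le> card ({..<m} \<union> ?V (w, x) \<union> ?V (w, y))"
    by (intro card_mono) auto
  also have "\<dots> \<le> card ({..<m} \<union> ?V (w, x)) + card (?V (w, y))"
    by (rule card_Un_le)
  also have "\<dots> \<le> (card {..<m} + card (?V (w, x))) + card (?V (w, y))"
    by (intro add_mono card_Un_le order_refl)
  finally show ?thesis by (simp add: mu.visits_def)
qed

text \<open>
  The points of \<open>D\<close> lie in as many cells as a Hamming ball around \<open>a\<close> has words, and each of these
  cells has mass less than \<open>exp (- c * n)\<close>.
\<close>

lemma measure_few_small_cells:
  fixes d t :: real
  assumes a: "a \<in> itineraries n" and t: "0 < t" "t \<le> 1"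
    and D: "D \<in> sets borel"
    and few: "\<And>y. y \<in> D \<Longrightarrow> (w, y) \<in> small_cells c n \<and>
      card {i. i < n \<and> itinerary n (w, y) i \<noteq> a i} \<le> d"
  shows "measure (\<kappa> w) D \<le> exp (card R * t * n + d * ln (1 / t)) * exp (- c * n)"
proof -
  interpret kw: prob_space "\<kappa> w" by (rule kernel_prob_space)
  let ?ball = "{b \<in> itineraries n. card {i. i < n \<and> b i \<noteq> a i} \<le> d}"
  let ?I = "{b \<in> ?ball. measure (\<kappa> w) (fiber (cylinder n b) w) < exp (- c * n)}"
  have fin: "finite ?ball" "finite ?I" using finite_itineraries by auto
  have "D \<subseteq> (\<Union>b\<in>?I. fiber (cylinder n b) w)"
  proof
    fix y assume "y \<in> D"
    from few[OF this] have y: "(w, y) \<in> E" "cell_mass n (w, y) < exp (- c * n)"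
      "card {i. i < n \<and> itinerary n (w, y) i \<noteq> a i} \<le> d"
      by (auto simp: small_cells_def)
    then have "itinerary n (w, y) \<in> ?I"
      using itinerary_in by (simp add: cell_mass_def)
    moreover have "y \<in> fiber (cylinder n (itinerary n (w, y))) w"
      using y(1) itinerary_in by (simp add: mem_cylinder_iff)
    ultimately show "y \<in> (\<Union>b\<in>?I. fiber (cylinder n b) w)" by blast
  qed
  then have "measure (\<kappa> w) D \<le> measure (\<kappa> w) (\<Union>b\<in>?I. fiber (cylinder n b) w)"
    using fin by (intro kw.finite_measure_mono) (auto intro!: sets.finite_UN fiber_sets cylinder_sets)
  also have "\<dots> \<le> (\<Sum>b\<in>?I. measure (\<kappa> w) (fiber (cylinder n b) w))"
    using fin by (intro kw.finite_measure_subadditive_finite) (auto intro!: fiber_sets cylinder_sets)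
  also have "\<dots> \<le> card ?I * exp (- c * n)"
    by (intro sum_bounded_above) auto
  also have "\<dots> \<le> card ?ball * exp (- c * n)"
    using fin by (intro mult_right_mono of_nat_mono card_mono) auto
  also have "\<dots> \<le> exp (card R * t * n + d * ln (1 / t)) * exp (- c * n)"
    using card_hamming_ball[OF finite_R, of n a t d] a t
    by (intro mult_right_mono) (auto simp: itineraries_def)
  finally show ?thesis .
qed

text \<open>
  Fix \<open>N\<close> and consider the points of the tail ball that visit \<open>B\<close> at most \<open>N + \<epsilon> * n\<close> times
  before time \<open>n\<close>. Their itineraries of length \<open>n\<close> lie in a Hamming ball around that of \<open>x\<close>,
  whose cardinality grows at most at the rate \<open>c / 2\<close>, by the hypothesis \<open>rate\<close>. Those whose
  \<open>n\<close>-cell is small therefore have mass of order \<open>exp (- c * n / 2)\<close>, which is summable. By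
  Borel-Cantelli almost none of these points has small cells infinitely often, whereas almost every
  point of the fibre does.
\<close>

lemma tail_ball_null:
  fixes t \<epsilon> :: real
  assumes B [measurable]: "B \<in> sets \<mu>"
    and sep: "\<And>y z. y \<in> E \<Longrightarrow> z \<in> E \<Longrightarrow> y \<notin> B \<Longrightarrow> z \<notin> B \<Longrightarrow> dist y z \<le> \<delta> \<Longrightarrow> symbol y = symbol z"
    and t: "0 < t" "t \<le> 1" and \<epsilon>: "0 \<le> \<epsilon>" and c: "0 < c"
    and rate: "card R * t + 2 * \<epsilon> * ln (1 / t) \<le> c / 2"
    and x: "(w, x) \<in> E" "\<And>n. real (mu.visits B n (w, x)) \<le> real M + \<epsilon> * n"
    and typical: "AE y in \<kappa> w. (\<exists>\<^sub>\<infinity>n. (w, y) \<in> small_cells c n) \<and>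
      (\<exists>N. \<forall>n. real (mu.visits B n (w, y)) \<le> real N + \<epsilon> * n)"
  shows "tail_ball \<delta> m w x \<in> null_sets (\<kappa> w)"
proof -
  interpret kw: prob_space "\<kappa> w" by (rule kernel_prob_space)
  define D where "D N n = tail_ball \<delta> m w x \<inter> fiber (small_cells c n) w \<inter>
    {y \<in> space borel. real (mu.visits B n (w, y)) \<le> real N + \<epsilon> * n}" for N n
  have D_sets [measurable]: "D N n \<in> sets borel" for N n
  proof -
    have [measurable]: "(\<lambda>y. real (mu.visits B n (w, y))) \<in> borel_measurable borel"
      using measurable_compose[OF Pair_measurable mu.visits_measurable[OF B]] .
    show ?thesis unfolding D_def by measurable
  qed
  have bound: "measure (\<kappa> w) (D N n) \<le> exp ((m + M + N) * ln (1 / t)) * exp (- c / 2) ^ n" for N n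
  proof -
    let ?d = "real m + M + N + 2 * \<epsilon> * n"
    have "measure (\<kappa> w) (D N n) \<le> exp (card R * t * n + ?d * ln (1 / t)) * exp (- c * n)"
    proof (rule measure_few_small_cells[OF itinerary_in[OF x(1)] t D_sets], intro conjI)
      fix y assume y: "y \<in> D N n"
      then show "(w, y) \<in> small_cells c n" by (simp add: D_def)
      have "card {i. i < n \<and> itinerary n (w, y) i \<noteq> itinerary n (w, x) i}
          \<le> m + mu.visits B n (w, x) + mu.visits B n (w, y)"
        using y by (intro tail_ball_itineraries[OF sep x(1)]) (auto simp: D_def)
      then show "card {i. i < n \<and> itinerary n (w, y) i \<noteq> itinerary n (w, x) i} \<le> ?d"
        using x(2)[of n] y by (simp add: D_def)
    qed
    also have "\<dots> = exp ((m + M + N) * ln (1 / t)) * exp ((card R * t + 2 * \<epsilon> * ln (1 / t) - c) * n)"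
      by (simp add: algebra_simps flip: exp_add)
    also have "\<dots> \<le> exp ((m + M + N) * ln (1 / t)) * exp (- c / 2 * n)"
    proof (intro mult_left_mono)
      show "exp ((card R * t + 2 * \<epsilon> * ln (1 / t) - c) * n) \<le> exp (- c / 2 * n)"
        unfolding exp_le_cancel_iff using rate by (intro mult_right_mono) auto
    qed simp
    also have "exp (- c / 2 * n) = exp (- c / 2) ^ n"
      by (simp add: mult.commute flip: exp_of_nat_mult)
    finally show ?thesis by simp
  qed
  have "AE y in \<kappa> w. eventually (\<lambda>n. y \<in> space (\<kappa> w) - D N n) sequentially" for N
  proof (rule borel_cantelli_AE1)
    show "summable (\<lambda>n. measure (\<kappa> w) (D N n))"
    proof (rule summable_comparison_test_ev)
      show "summable (\<lambda>n. exp ((m + M + N) * ln (1 / t)) * exp (- c / 2) ^ n)"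
        using c by (intro summable_mult summable_geometric) simp
      show "eventually (\<lambda>n. norm (measure (\<kappa> w) (D N n)) \<le> exp ((m + M + N) * ln (1 / t)) * exp (- c / 2) ^ n) sequentially"
        using bound by simp
    qed
  qed (auto simp: kw.emeasure_eq_measure)
  then have "AE y in \<kappa> w. \<forall>N. eventually (\<lambda>n. y \<notin> D N n) sequentially"
    by (simp add: AE_all_countable)
  then have "AE y in \<kappa> w. y \<notin> tail_ball \<delta> m w x"
    using typical
  proof eventually_elim
    case (elim y)
    show ?case
    proof
      assume y: "y \<in> tail_ball \<delta> m w x"
      obtain N where N: "\<And>n. real (mu.visits B n (w, y)) \<le> real N + \<epsilon> * n"
        using elim by blast
      obtain n0 where n0: "\<And>n. n \<ge> n0 \<Longrightarrow> y \<notin> D N n"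
        using elim(1) unfolding eventually_sequentially by blast
      obtain n where "n \<ge> n0" "(w, y) \<in> small_cells c n"
        using elim(2) unfolding INFM_nat_le by blast
      then show False using y N n0 by (auto simp: D_def)
    qed
  qed
  then show ?thesis
    by (subst AE_iff_null_sets) auto
qed

text \<open>
  Lemma \<open>tail_ball_null\<close> applies to typical centres only, but the conclusion concerns every point of
  the fibre. A tail ball of radius \<open>\<delta> / 2\<close> that contains a typical point is contained in the tail
  ball of radius \<open>\<delta>\<close> around it; one that contains no typical point is null anyway.
\<close>

lemma AE_tail_balls_null:
  assumes pos: "partition_relative_entropy P \<theta> E f \<kappa> R > 0"
  obtains \<delta> where "0 < \<delta>"
    "AE w in P. \<forall>x\<in>fiber E w. \<forall>m. tail_ball \<delta> m w x \<in> null_sets (\<kappa> w)"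
proof -
  obtain c where c: "0 < c" and small: "AE z in \<mu>. \<exists>\<^sub>\<infinity>n. z \<in> small_cells c n"
    using AE_small_cells_infinitely_often[OF pos] by blast
  \<comment> \<open>The constants are chosen so that both terms of the exponential growth rate of the Hamming balls,
    \<open>card R * t\<close> and \<open>2 * \<epsilon> * ln (1 / t)\<close>, are at most \<open>c / 4\<close>.\<close>
  define t where "t = min 1 (c / (4 * card R))"
  have q: "1 \<le> real (card R)" using one_le_card_R by simp
  have t: "0 < t" "t \<le> 1" using c q by (auto simp: t_def)
  have "card R * t \<le> card R * (c / (4 * card R))"
    unfolding t_def by (intro mult_left_mono) auto
  then have qt: "card R * t \<le> c / 4" using q by simp
  define \<epsilon> where "\<epsilon> = c / (8 * (ln (1 / t) + 1))"
  have L: "0 \<le> ln (1 / t)" using t by simp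
  have \<epsilon>: "0 < \<epsilon>" unfolding \<epsilon>_def using c L by (intro divide_pos_pos) auto
  have "2 * \<epsilon> * ln (1 / t) \<le> 2 * \<epsilon> * (ln (1 / t) + 1)"
    using \<epsilon> by simp
  also have "\<dots> = c / 4"
  proof -
    have "ln (1 / t) + 1 \<noteq> 0" using L by linarith
    then show ?thesis by (simp only: \<epsilon>_def) (simp add: field_simps)
  qed
  finally have rate: "card R * t + 2 * \<epsilon> * ln (1 / t) \<le> c / 2"
    using qt by simp
  obtain \<delta> B where \<delta>: "0 < \<delta>" and B [measurable]: "B \<in> sets \<mu>" and "mu.prob B < \<epsilon>"
    and sep: "\<And>y z. y \<in> E \<Longrightarrow> z \<in> E \<Longrightarrow> y \<notin> B \<Longrightarrow> z \<notin> B \<Longrightarrow> dist y z \<le> \<delta> \<Longrightarrow> symbol y = symbol z"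
    using separated_cores[OF \<epsilon>] by metis
  define C where "C = {z \<in> space \<mu>. z \<in> E \<and> (\<exists>\<^sub>\<infinity>n. z \<in> small_cells c n) \<and>
    (\<exists>N. \<forall>n. real (mu.visits B n z) \<le> real N + \<epsilon> * n)}"
  have "C \<in> sets \<mu>"
    unfolding C_def INFM_nat_le by measurable
  moreover have "AE z in \<mu>. z \<in> C"
    using small mu.AE_visits_linear_bound[OF B \<open>mu.prob B < \<epsilon>\<close>] AE_mu_E
    by eventually_elim (auto simp: C_def)
  ultimately have "AE w in P. AE y in \<kappa> w. (w, y) \<in> C"
    by (rule AE_kernel_fiber)
  then have "AE w in P. \<forall>x\<in>fiber E w. \<forall>m. tail_ball (\<delta> / 2) m w x \<in> null_sets (\<kappa> w)"
  proof eventually_elim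
    case (elim w)
    show ?case
    proof (intro ballI allI)
      fix x m assume "x \<in> fiber E w"
      show "tail_ball (\<delta> / 2) m w x \<in> null_sets (\<kappa> w)"
      proof (cases "\<exists>y\<in>tail_ball (\<delta> / 2) m w x. (w, y) \<in> C")
        case True
        then obtain y where y: "y \<in> tail_ball (\<delta> / 2) m w x" and yC: "(w, y) \<in> C" by blast
        obtain M where M: "\<And>n. real (mu.visits B n (w, y)) \<le> real M + \<epsilon> * n"
          using yC by (auto simp: C_def)
        have "AE y in \<kappa> w. (\<exists>\<^sub>\<infinity>n. (w, y) \<in> small_cells c n) \<and>
            (\<exists>N. \<forall>n. real (mu.visits B n (w, y)) \<le> real N + \<epsilon> * n)"
          using elim by eventually_elim (auto simp: C_def)
        then have "tail_ball \<delta> m w y \<in> null_sets (\<kappa> w)"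
          using yC \<epsilon> by (intro tail_ball_null[OF B sep t _ c rate _ M]) (auto simp: C_def)
        then show ?thesis
          by (rule null_sets_subset[OF _ _ tail_ball_subset_tail_ball[OF y]]) simp
      next
        case False
        have "AE y in \<kappa> w. y \<notin> tail_ball (\<delta> / 2) m w x"
          using elim by eventually_elim (use False in blast)
        then show ?thesis
          by (subst AE_iff_null_sets) auto
      qed
    qed
  qed
  then show ?thesis using \<delta> that[of "\<delta> / 2"] by simp
qed

end

section \<open>Positive entropy implies expansivity\<close>

theorem theoremA:
  fixes P :: "'w :: polish_space measure"
    and \<theta> :: "'w \<Rightarrow> 'w"
    and E :: "('w \<times> 'x :: polish_space) set"
    and f :: "'w \<Rightarrow> 'x \<Rightarrow> 'x"
    and \<mu> :: "('w \<times> 'x) measure"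
    and \<kappa> :: "'w \<Rightarrow> 'x measure"
  assumes "bundle_rds P \<theta> E f"
    and "\<mu> \<in> invariant_measures P \<theta> E f"
    and "ergodic_measure \<theta> E f \<mu>"
    and "disintegration P E \<mu> \<kappa>"
    and "relative_entropy P \<theta> E f \<kappa> > 0"
  shows "positively_random_expansive P \<theta> E f \<kappa> \<and>
    (AE w in P. \<forall>p \<in> fiber E w. stable_class \<theta> E f w p \<in> null_sets (\<kappa> w))"
proof -
  obtain R where R: "finite_measurable_partition P E R"
    and pos: "partition_relative_entropy P \<theta> E f \<kappa> R > 0"
    using assms(5) by (auto simp: relative_entropy_def less_SUP_iff)
  interpret ergodic_rds P \<theta> E f \<mu> \<kappa>
    using assms by (intro ergodic_rds.intro ergodic_rds_axioms.intro)
  interpret partitioned_rds P \<theta> E f \<mu> \<kappa> R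
    by unfold_locales (rule R)
  obtain \<delta> where \<delta>: "0 < \<delta>"
    and null: "AE w in P. \<forall>x\<in>fiber E w. \<forall>m. tail_ball \<delta> m w x \<in> null_sets (\<kappa> w)"
    using AE_tail_balls_null[OF pos] by blast
  have "positively_random_expansive P \<theta> E f \<kappa>"
    unfolding positively_random_expansive_def
  proof (intro bexI[of _ "\<lambda>_. \<delta>"] conjI)
    show "AE w in P. \<forall>x\<in>fiber E w. Gamma_plus \<theta> E f (\<lambda>_. \<delta>) x w \<in> null_sets (\<kappa> w)"
      using null by eventually_elim (simp add: Gamma_plus_eq_tail_ball)
  qed (use \<delta> in auto)
  moreover have "AE w in P. \<forall>p\<in>fiber E w. stable_class \<theta> E f w p \<in> null_sets (\<kappa> w)"
    using null
  proof eventually_elim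
    case (elim w)
    show ?case
    proof
      fix p assume "p \<in> fiber E w"
      then have "(\<Union>m. tail_ball \<delta> m w p) \<in> null_sets (\<kappa> w)"
        using elim by (intro null_sets_UN) auto
      then show "stable_class \<theta> E f w p \<in> null_sets (\<kappa> w)"
        by (rule null_sets_subset[OF _ _ stable_class_subset_tail_balls[OF \<delta>]]) simp
    qed
  qed
  ultimately show ?thesis ..
qed

end
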